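(* Let $K$ be a commutative ring with identity, $x\in K$ invertible, $q=x^2$, $\gamma,\delta_e\in K$, $n\ge1$, and let $b_n$ be the blob algebra over $K$ with parameters $q,\gamma,\delta_e$. Then any mirror representation of $b_n$ (over $K$) is faithful.
   Context: TL diagrams. For an integer $N\ge1$, an $(N,N)$ TL (Temperley--Lieb) diagram is a rectangular frame with $N$ northern nodes labelled $1,\dots,N$ and $N$ southern nodes labelled $1',\dots,N'$ (left to right), connected in pairs by non-touching lines in the plane interior to the frame; diagrams are identified if they pair the nodes in the same way. $(ij)\in D$ means that nodes $i,j$ (primed, unprimed or mixed) are connected in $D$. Blob algebra. A line in a TL diagram is exposed if it may be deformed (within the frame, without touching other lines) to touch the western edge of the frame. A blob diagram is a TL diagram in which any exposed line may be decorated with a blob; $\mathcal D^b(n,n)$ is the set of $(n,n)$ blob diagrams (each line carrying at most one blob). The blob algebra $b_n$ is the $K$-algebra with basis $\mathcal D^b(n,n)$ and multiplication by stacking diagrams (first factor on top), where: two blobs on the same line are replaced by one blob and a factor $\delta_e$; a closed loop without a blob is removed with a factor $[2]=q+q^{-1}$; and a closed loop with a blob is removed with a factor $\gamma$. Let $\mathcal U_i\in b_n$ ($1\le i\le n-1$) be the undecorated diagram with $(i\;i{+}1),(i'\;(i{+}1)')\in\mathcal U_i$ and $(jj')\in\mathcal U_i$ for $j\neq i,i+1$, and let $e\in b_n$ be the identity diagram (all lines $(jj')$) with a blob on the leftmost line $(11')$. Matrices. Index the standard Temperley--Lieb diagrams on $2n$ strands by shifted indices $U_{-n+1},\dots,U_0,\dots,U_{n-1}$: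 $U_j$ is the $(2n,2n)$ TL diagram joining $n+j$ to $n+j+1$, $(n+j)'$ to $(n+j+1)'$, and $k$ to $k'$ for all other $k$. For an invertible element $p$ with a chosen square root in $K$, and a $(2n,2n)$ TL diagram $D$, $R_p(D)$ is the $2^{2n}\times2^{2n}$ matrix with rows and columns indexed by words $v,w$ of length $2n$ in $\{1,2\}$ and entries $$R_p(D)_{vw}=\Bigl(\prod_{i<j,\ (ij)\in D} p^{\mathrm{sign}(v_i-v_j)/2}\,\delta'_{v_iv_j}\Bigr)\Bigl(\prod_{(ij')\in D}\delta_{v_iw_j}\Bigr)\Bigl(\prod_{i<j,\ (i'j')\in D} p^{\mathrm{sign}(w_i-w_j)/2}\,\delta'_{w_iw_j}\Bigr),$$ where $v_i$ is the $i$-th term of $v$, $\delta_{ab}=1$ if $a=b$ and $0$ otherwise, $\delta'_{ab}=1-\delta_{ab}$, $\mathrm{sign}(a)=\pm1$ according to the sign of a nonzero integer $a$, and a factor containing $\delta'_{aa}$ is read as $0$. Two matrices $M,N$ of the same shape are mask equivalent if $M_{ij}=0\iff N_{ij}=0$ for all $i,j$; $[M]$ is the mask equivalence class of $M$. The class $[R_p(D)]$ does not depend on $p$. Mirror representation. A representation $\rho$ of $b_n$ (a $K$-algebra homomorphism from $b_n$ to the algebra of $2^{2n}\times2^{2n}$ matrices over $K$) is called a mirror representation if $\rho(e)\in[R_r(U_0)]$ and, for each $1\le i\le n-1$, $\rho(\mathcal U_i)=X_iY_i$ for some $X_i\in[R_s(U_{-i})]$ and $Y_i\in[R_t(U_i)]$,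 for some $r,s,t$.
   Formalization: Added: nonzero entries of ρ(e), X_i, Y_i are non-zero-divisors (automatic over integral domains and for R_p(D) itself). Without it the claim fails: K=Z/4, n=1, δ_e=0, ρ(e) with entries 2 on the mask of U_0 gives ρ(2e)=0. *)

theory Defs
  imports "HOL-Algebra.Module" "HOL-Library.Disjoint_Sets"
begin

datatype node = North nat | South nat

definition nodes :: "nat \<Rightarrow> node set" where
  "nodes N = North ` {1..N} \<union> South ` {1..N}"

text \<open>Position of a node when the frame is traversed clockwise, starting and ending
  at the western edge: \<open>1, \<dots>, N, N', \<dots>, 1'\<close>.\<close>

fun pos :: "nat \<Rightarrow> node \<Rightarrow> nat" where
  "pos N (North i) = i"
| "pos N (South i) = 2 * N + 1 - i"

text \<open>A diagram is the set of its lines and a line is the set of its two ends. A pairing of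
  nodes can be drawn in the frame without touching lines iff no two of its lines have ends that
  interleave along the frame.\<close>

definition TL_diagrams :: "nat \<Rightarrow> node set set set" where
  "TL_diagrams N = {D. partition_on (nodes N) D \<and> (\<forall>l\<in>D. card l = 2) \<and>
     \<not> (\<exists>a b c d. {a, c} \<in> D \<and> {b, d} \<in> D \<and>
         pos N a < pos N b \<and> pos N b < pos N c \<and> pos N c < pos N d)}"

text \<open>The western edge lies between the last and the first position, so the lines separating
  a line from the western edge are exactly those whose ends enclose both of its ends.\<close>

definition exposed :: "nat \<Rightarrow> node set set \<Rightarrow> node set \<Rightarrow> bool" where
  "exposed N D l \<longleftrightarrow> l \<in> D \<and>
     \<not> (\<exists>c d. {c, d} \<in> D \<and> (\<forall>a\<in>l. pos N c < pos N a \<and> pos N a < pos N d))"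

text \<open>The second component is the set of lines carrying a blob.\<close>

type_synonym blob_diagram = "node set set \<times> node set set"

definition blob_diagrams :: "nat \<Rightarrow> blob_diagram set" where
  "blob_diagrams n = {(D, B). D \<in> TL_diagrams n \<and> B \<subseteq> {l. exposed n D l}}"

definition id_lines :: "nat \<Rightarrow> node set set" where
  "id_lines N = {{North j, South j} | j. j \<in> {1..N}}"

definition cup_cap :: "nat \<Rightarrow> nat \<Rightarrow> node set set" where
  "cup_cap N k = {{North k, North (k + 1)}, {South k, South (k + 1)}} \<union>
     {{North j, South j} | j. j \<in> {1..N} - {k, k + 1}}"

text \<open>When \<open>d1\<close> is put on top of \<open>d2\<close>, the southern nodes of \<open>d1\<close> and the northern nodes of
  \<open>d2\<close> are identified in the middle row.\<close>

datatype vertex = Top nat | Middle nat | Bottom nat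

fun upper :: "node \<Rightarrow> vertex" where
  "upper (North i) = Top i"
| "upper (South i) = Middle i"

fun lower :: "node \<Rightarrow> vertex" where
  "lower (North i) = Middle i"
| "lower (South i) = Bottom i"

definition joined :: "blob_diagram \<Rightarrow> blob_diagram \<Rightarrow> (vertex \<times> vertex) set" where
  "joined d1 d2 = (\<Union>l\<in>fst d1. upper ` l \<times> upper ` l) \<union> (\<Union>l\<in>fst d2. lower ` l \<times> lower ` l)"

text \<open>The vertex sets of the lines and closed loops of the stacked picture.\<close>

definition strands :: "nat \<Rightarrow> blob_diagram \<Rightarrow> blob_diagram \<Rightarrow> vertex set set" where
  "strands n d1 d2 = (\<lambda>v. (joined d1 d2)\<^sup>* `` {v}) `
     (Top ` {1..n} \<union> Middle ` {1..n} \<union> Bottom ` {1..n})"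

definition blob_count :: "blob_diagram \<Rightarrow> blob_diagram \<Rightarrow> vertex set \<Rightarrow> nat" where
  "blob_count d1 d2 C = card {l \<in> snd d1. upper ` l \<subseteq> C} + card {l \<in> snd d2. lower ` l \<subseteq> C}"

definition outer :: "vertex set \<Rightarrow> node set" where
  "outer C = {North i | i. Top i \<in> C} \<union> {South i | i. Bottom i \<in> C}"

definition stack :: "nat \<Rightarrow> blob_diagram \<Rightarrow> blob_diagram \<Rightarrow> blob_diagram" where
  "stack n d1 d2 =
    (outer ` {C \<in> strands n d1 d2. outer C \<noteq> {}},
     outer ` {C \<in> strands n d1 d2. outer C \<noteq> {} \<and> blob_count d1 d2 C > 0})"

definition unit_inv :: "'k::comm_ring_1 \<Rightarrow> 'k" where
  "unit_inv a = (THE b. a * b = 1)"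

text \<open>Closed loops are the strands with \<open>outer C = {}\<close>. A strand carrying \<open>m \<ge> 1\<close> blobs
  contributes \<open>\<delta> ^ (m - 1)\<close>; for \<open>m = 0\<close> the truncated exponent is \<open>0\<close>, too.\<close>

definition stack_factor ::
    "nat \<Rightarrow> 'k::comm_ring_1 \<Rightarrow> 'k \<Rightarrow> 'k \<Rightarrow> blob_diagram \<Rightarrow> blob_diagram \<Rightarrow> 'k" where
  "stack_factor n q \<gamma> \<delta> d1 d2 = (\<Prod>C\<in>strands n d1 d2.
     \<delta> ^ (blob_count d1 d2 C - 1) *
     (if outer C \<noteq> {} then 1 else if blob_count d1 d2 C = 0 then q + unit_inv q else \<gamma>))"

definition basis_vec :: "blob_diagram \<Rightarrow> blob_diagram \<Rightarrow> 'k::comm_ring_1" where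
  "basis_vec d = (\<lambda>d'. if d' = d then 1 else 0)"

text \<open>An element is the family of its coefficients with respect to the basis of blob diagrams.\<close>

definition blob_algebra ::
    "nat \<Rightarrow> 'k::comm_ring_1 \<Rightarrow> 'k \<Rightarrow> 'k \<Rightarrow> ('k, blob_diagram \<Rightarrow> 'k) module" where
  "blob_algebra n q \<gamma> \<delta> =
    \<lparr>carrier = {f. \<forall>d. d \<notin> blob_diagrams n \<longrightarrow> f d = 0},
     monoid.mult = (\<lambda>f g d. \<Sum>d1\<in>blob_diagrams n. \<Sum>d2\<in>blob_diagrams n.
       if stack n d1 d2 = d then f d1 * g d2 * stack_factor n q \<gamma> \<delta> d1 d2 else 0),
     one = basis_vec (id_lines n, {}),
     zero = (\<lambda>d. 0),
     add = (\<lambda>f g d. f d + g d),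
     smult = (\<lambda>c f d. c * f d)\<rparr>"

definition blob_U :: "nat \<Rightarrow> nat \<Rightarrow> blob_diagram \<Rightarrow> 'k::comm_ring_1" where
  "blob_U n i = basis_vec (cup_cap n i, {})"

definition blob_e :: "nat \<Rightarrow> blob_diagram \<Rightarrow> 'k::comm_ring_1" where
  "blob_e n = basis_vec (id_lines n, {{North 1, South 1}})"

definition words :: "nat \<Rightarrow> nat list set" where
  "words N = {v. length v = N \<and> set v \<subseteq> {1, 2}}"

type_synonym 'k word_matrix = "nat list \<Rightarrow> nat list \<Rightarrow> 'k"

definition matrix_algebra :: "nat \<Rightarrow> ('k::comm_ring_1, 'k word_matrix) module" where
  "matrix_algebra N =
    \<lparr>carrier = {M. \<forall>v w. v \<notin> words N \<or> w \<notin> words N \<longrightarrow> M v w = 0},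
     monoid.mult = (\<lambda>A B v w. \<Sum>u\<in>words N. A v u * B u w),
     one = (\<lambda>v w. if v \<in> words N \<and> v = w then 1 else 0),
     zero = (\<lambda>v w. 0),
     add = (\<lambda>A B v w. A v w + B v w),
     smult = (\<lambda>c A v w. c * A v w)\<rparr>"

text \<open>The factor of a line joining two nodes of the same row that carry the letters \<open>a\<close>
  (left) and \<open>b\<close> (right). The parameter \<open>h\<close> is the chosen square root of \<open>p\<close>.\<close>

definition arc_weight :: "'k::comm_ring_1 \<Rightarrow> nat \<Rightarrow> nat \<Rightarrow> 'k" where
  "arc_weight h a b = (if a = b then 0 else if a > b then h else unit_inv h)"

text \<open>\<open>R_matrix N h D\<close> is the matrix \<open>R_p(D)\<close> with \<open>p = h\<^sup>2\<close>. Node \<open>i\<close> carries the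
  list entry with index \<open>i - 1\<close>.\<close>

definition R_matrix :: "nat \<Rightarrow> 'k::comm_ring_1 \<Rightarrow> node set set \<Rightarrow> 'k word_matrix" where
  "R_matrix N h D = (\<lambda>v w. if v \<in> words N \<and> w \<in> words N then
     (\<Prod>(i, j)\<in>{(i, j). i < j \<and> {North i, North j} \<in> D}. arc_weight h (v ! (i - 1)) (v ! (j - 1))) *
     (\<Prod>(i, j)\<in>{(i, j). {North i, South j} \<in> D}. if v ! (i - 1) = w ! (j - 1) then 1 else 0) *
     (\<Prod>(i, j)\<in>{(i, j). i < j \<and> {South i, South j} \<in> D}. arc_weight h (w ! (i - 1)) (w ! (j - 1)))
     else 0)"

definition mask_equiv :: "nat \<Rightarrow> 'k::comm_ring_1 word_matrix \<Rightarrow> 'k word_matrix \<Rightarrow> bool" where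
  "mask_equiv N A B \<longleftrightarrow> (\<forall>v\<in>words N. \<forall>w\<in>words N. A v w = 0 \<longleftrightarrow> B v w = 0)"

text \<open>The diagram \<open>U\<^sub>j\<close> on \<open>2 * n\<close> strands with shifted index \<open>- n < j < n\<close>.\<close>

definition shifted_U :: "nat \<Rightarrow> int \<Rightarrow> node set set" where
  "shifted_U n j = cup_cap (2 * n) (nat (int n + j))"

definition representation ::
    "nat \<Rightarrow> 'k::comm_ring_1 \<Rightarrow> 'k \<Rightarrow> 'k \<Rightarrow> ((blob_diagram \<Rightarrow> 'k) \<Rightarrow> 'k word_matrix) \<Rightarrow> bool" where
  "representation n q \<gamma> \<delta> \<rho> \<longleftrightarrow>
     \<rho> \<in> ring_hom (blob_algebra n q \<gamma> \<delta>) (matrix_algebra (2 * n)) \<and>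
     (\<forall>c. \<forall>f\<in>carrier (blob_algebra n q \<gamma> \<delta>).
        \<rho> (c \<odot>\<^bsub>blob_algebra n q \<gamma> \<delta>\<^esub> f) = c \<odot>\<^bsub>matrix_algebra (2 * n)\<^esub> \<rho> f)"

text \<open>\<open>\<rho>\<close> is a mirror representation iff this holds for some \<open>X\<close> and \<open>Y\<close>; the factors are
  arguments so that conditions on them can be stated. The scalars \<open>hr\<close>, \<open>hs\<close>, \<open>ht\<close> are the
  chosen square roots of the invertible elements \<open>r\<close>, \<open>s\<close>, \<open>t\<close>.\<close>

definition mirror_representation ::
    "nat \<Rightarrow> 'k::comm_ring_1 \<Rightarrow> 'k \<Rightarrow> 'k \<Rightarrow> ((blob_diagram \<Rightarrow> 'k) \<Rightarrow> 'k word_matrix) \<Rightarrow>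
     (nat \<Rightarrow> 'k word_matrix) \<Rightarrow> (nat \<Rightarrow> 'k word_matrix) \<Rightarrow> bool" where
  "mirror_representation n q \<gamma> \<delta> \<rho> X Y \<longleftrightarrow>
     representation n q \<gamma> \<delta> \<rho> \<and>
     (\<exists>hr hs ht. hr dvd 1 \<and> hs dvd 1 \<and> ht dvd 1 \<and>
       mask_equiv (2 * n) (\<rho> (blob_e n)) (R_matrix (2 * n) hr (shifted_U n 0)) \<and>
       (\<forall>i. 1 \<le> i \<and> i \<le> n - 1 \<longrightarrow>
          X i \<in> carrier (matrix_algebra (2 * n)) \<and>
          Y i \<in> carrier (matrix_algebra (2 * n)) \<and>
          mask_equiv (2 * n) (X i) (R_matrix (2 * n) hs (shifted_U n (- int i))) \<and>
          mask_equiv (2 * n) (Y i) (R_matrix (2 * n) ht (shifted_U n (int i))) \<and>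
          \<rho> (blob_U n i) = X i \<otimes>\<^bsub>matrix_algebra (2 * n)\<^esub> Y i))"

text \<open>Every nonzero entry is a non-zero-divisor. This is automatic over an integral domain, and
  for the matrices \<open>R_p(D)\<close> themselves over every ring, as their nonzero entries are units.
  Without it a mirror representation need not be faithful: over the integers modulo \<open>4\<close>, with
  \<open>n = 1\<close> and \<open>\<delta> = 0\<close>, let \<open>\<rho> (blob_e 1)\<close> have the entry \<open>2\<close> wherever
  \<open>R_matrix 2 1 (shifted_U 1 0)\<close> is nonzero and \<open>0\<close> elsewhere. Then \<open>\<rho> (blob_e 1)\<close> squares
  to \<open>0\<close>, and \<open>\<rho>\<close> maps \<open>2\<close> times \<open>blob_e 1\<close> to \<open>0\<close>.\<close>

definition regular_entries :: "'k::comm_ring_1 word_matrix \<Rightarrow> bool" where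
  "regular_entries M \<longleftrightarrow> (\<forall>v w. M v w \<noteq> 0 \<longrightarrow> (\<forall>c. c * M v w = 0 \<longrightarrow> c = 0))"

end

theory Submission
  imports Defs
begin

text \<open>Unfold a blob diagram along its western edge into a symmetric Temperley--Lieb diagram on
  \<open>2 * n\<close> strands: every line is doubled, and a line with a blob becomes two lines that cross the
  mirror axis and join each of its ends to the mirror image of that end. Every diagram is a product
  of generators in which no loop and no second blob on a line arises. At most one intermediate word
  then contributes to each entry of the product of the representing matrices, so the matrix of a
  diagram has a nonzero entry exactly where the two words are compatible with the unfolded diagram,
  and this entry is no zero divisor.

  Linear independence follows by triangularity. Mark a node of a diagram if it carries a blob or
  is the first end of its line, give the marked nodes and the unmarked ones different letters in the
  east half, and give their mirror images the opposite letters. If another diagram is compatible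
  with these words, then the marks of that diagram are at least as far forward, with equality only
  if the diagrams agree.\<close>

section \<open>Noncrossing pairings\<close>

text \<open>Only the zero patterns of the factors are given, so no entry can be computed. What
  survives multiplication is regularity: a product of regular entries is regular, whereas a sum of
  several such products may vanish. This is why the factorisation must avoid loops. In the unfolded
  picture a second blob on a line also closes a loop, and a loop leaves letters of the middle row
  free. A blob line needs two unfolded lines because the cup of \<open>U_0\<close> sits on the axis:
  it compares the two mirror images of one node and says nothing about the other end of the line.
  Opposite letters on mirror images therefore satisfy all blob lines at once, and only the plain
  lines constrain the marks. Marks behave like brackets: a plain line matches a marked node with a
  later unmarked one, and the ends of blob lines are the marked nodes left unmatched. Matching
  brackets recovers the plain lines. The blob lines, being exposed, cannot be nested and so pair the
  remaining nodes consecutively.\<close>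

lemma North_in_nodes [simp]: "North i \<in> nodes N \<longleftrightarrow> 1 \<le> i \<and> i \<le> N"
  and South_in_nodes [simp]: "South i \<in> nodes N \<longleftrightarrow> 1 \<le> i \<and> i \<le> N"
  by (auto simp: nodes_def)

lemma finite_nodes [simp]: "finite (nodes N)"
  by (simp add: nodes_def)

lemma pos_range: "a \<in> nodes N \<Longrightarrow> 1 \<le> pos N a \<and> pos N a \<le> 2 * N"
  by (cases a) auto

lemma pos_eq_iff: "a \<in> nodes N \<Longrightarrow> b \<in> nodes N \<Longrightarrow> pos N a = pos N b \<longleftrightarrow> a = b"
  by (cases a; cases b) auto

lemma pos_surj:
  assumes "1 \<le> p" "p \<le> 2 * N"
  obtains a where "a \<in> nodes N" "pos N a = p"
proof (cases "p \<le> N")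
  case True
  then show ?thesis using assms that[of "North p"] by simp
next
  case False
  then have "South (2 * N + 1 - p) \<in> nodes N" "pos N (South (2 * N + 1 - p)) = p"
    using assms by auto
  then show ?thesis using that by blast
qed

lemma card_nodes_between:
  assumes "1 \<le> p" "q \<le> 2 * N"
  shows "card {a \<in> nodes N. p \<le> pos N a \<and> pos N a \<le> q} = card {p..q}"
proof -
  have "bij_betw (pos N) {a \<in> nodes N. p \<le> pos N a \<and> pos N a \<le> q} {p..q}"
  proof (rule bij_betwI')
    fix y assume "y \<in> {p..q}"
    then obtain a where "a \<in> nodes N" "pos N a = y"
      using pos_surj[of y N] assms by auto
    then show "\<exists>x\<in>{a \<in> nodes N. p \<le> pos N a \<and> pos N a \<le> q}. y = pos N x"
      using \<open>y \<in> {p..q}\<close> by auto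
  qed (auto simp: pos_eq_iff)
  then show ?thesis by (rule bij_betw_same_card)
qed

lemma TL_I:
  assumes "\<And>l. l \<in> D \<Longrightarrow> \<exists>a\<in>nodes N. \<exists>b\<in>nodes N. a \<noteq> b \<and> l = {a, b}"
    and "\<And>a. a \<in> nodes N \<Longrightarrow> \<exists>l\<in>D. a \<in> l"
    and "\<And>l l' a. l \<in> D \<Longrightarrow> l' \<in> D \<Longrightarrow> a \<in> l \<Longrightarrow> a \<in> l' \<Longrightarrow> l = l'"
    and "\<And>a b c d. {a, c} \<in> D \<Longrightarrow> {b, d} \<in> D \<Longrightarrow> pos N a < pos N b \<Longrightarrow> pos N b < pos N c \<Longrightarrow>
      pos N c < pos N d \<Longrightarrow> False"
  shows "D \<in> TL_diagrams N"
proof -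
  have "partition_on (nodes N) D"
  proof (rule partition_onI)
    show "\<Union>D = nodes N" using assms(1,2) by blast
    show "\<And>p q. p \<in> D \<Longrightarrow> q \<in> D \<Longrightarrow> p \<noteq> q \<Longrightarrow> disjnt p q"
      using assms(3) unfolding disjnt_def by blast
    show "{} \<notin> D" using assms(1) by blast
  qed
  moreover have "\<forall>l\<in>D. card l = 2" using assms(1) by (metis card_2_iff)
  ultimately show ?thesis using assms(4) unfolding TL_diagrams_def by blast
qed

lemma TL_Union: "D \<in> TL_diagrams N \<Longrightarrow> \<Union>D = nodes N"
  by (simp add: TL_diagrams_def partition_on_def)

context
  fixes N :: nat and D :: "node set set"
  assumes TL: "D \<in> TL_diagrams N"
begin

lemma TL_ends: "{a, b} \<in> D \<Longrightarrow> a \<in> nodes N \<and> b \<in> nodes N \<and> a \<noteq> b"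
  using TL unfolding TL_diagrams_def partition_on_def by fastforce

lemma TL_lineE:
  assumes "l \<in> D"
  obtains a b where "l = {a, b}" "pos N a < pos N b"
proof -
  have "card l = 2" using TL assms unfolding TL_diagrams_def by auto
  then obtain a b where l: "l = {a, b}" by (meson card_2_iff)
  then have "pos N a \<noteq> pos N b" using TL_ends assms pos_eq_iff by blast
  then show ?thesis using that[of a b] that[of b a] l by (metis insert_commute linorder_neqE_nat)
qed

lemma TL_same_line: "l \<in> D \<Longrightarrow> l' \<in> D \<Longrightarrow> a \<in> l \<Longrightarrow> a \<in> l' \<Longrightarrow> l = l'"
  using TL unfolding TL_diagrams_def partition_on_def disjoint_def by blast

lemma TL_unique:
  assumes "{a, b} \<in> D" "{a, c} \<in> D"
  shows "b = c"
proof -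
  have "{a, b} = {a, c}" using TL_same_line assms by blast
  then show ?thesis by (metis doubleton_eq_iff)
qed

lemma TL_cover: "a \<in> nodes N \<Longrightarrow> \<exists>l\<in>D. a \<in> l"
  using TL unfolding TL_diagrams_def partition_on_def by blast

lemma TL_partner:
  assumes "a \<in> nodes N"
  obtains b where "{a, b} \<in> D"
proof -
  obtain l where l: "l \<in> D" "a \<in> l" using TL_cover[OF assms] by blast
  obtain c d where "l = {c, d}" using TL_lineE[OF l(1)] by metis
  then show ?thesis using that[of c] that[of d] l by (auto simp: insert_commute)
qed

text \<open>The only escapes for \<open>d\<close> are beyond \<open>b\<close> or before
  \<open>a\<close>. Each is the forbidden interleaving, the second with the roles of the two lines
  exchanged.\<close>

lemma TL_nested:
  assumes "{a, b} \<in> D" "{c, d} \<in> D" "pos N a < pos N c" "pos N c < pos N b"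
  shows "pos N a < pos N d \<and> pos N d < pos N b"
proof -
  have nc: "\<And>a b c d. {a, c} \<in> D \<Longrightarrow> {b, d} \<in> D \<Longrightarrow> pos N a < pos N b \<Longrightarrow> pos N b < pos N c \<Longrightarrow>
      \<not> pos N c < pos N d"
    using TL unfolding TL_diagrams_def by blast
  have "pos N d \<noteq> pos N b" "pos N d \<noteq> pos N a"
    using assms TL_ends TL_unique pos_eq_iff by (metis insert_commute less_irrefl)+
  then show ?thesis
    using nc[of a b c d] nc[of d c a b] assms by (force simp: insert_commute)
qed

text \<open>By noncrossing, a line enclosing one end of \<open>l\<close> encloses both, so exposure
  can be tested at any single end.\<close>

lemma exposed_iff:
  assumes "l \<in> D" "a \<in> l"
  shows "exposed N D l \<longleftrightarrow> \<not> (\<exists>c d. {c, d} \<in> D \<and> pos N c < pos N a \<and> pos N a < pos N d)"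
proof -
  obtain c d where "l = {c, d}" using TL_lineE[OF assms(1)] by metis
  then obtain b where l: "l = {a, b}" using assms(2) by auto
  show ?thesis
    using assms TL_nested[of _ _ a b] unfolding exposed_def l by auto
qed

text \<open>Such a set is a union of two-element lines. Contrapositively, an odd stretch of the
  frame must have a line leaving it, which is how \<open>next_crossing\<close> finds its
  line.\<close>

lemma TL_even_card:
  assumes "S \<subseteq> nodes N" and closed: "\<And>a b. {a, b} \<in> D \<Longrightarrow> a \<in> S \<Longrightarrow> b \<in> S"
  shows "even (card S)"
proof -
  define P where "P = {l \<in> D. l \<subseteq> S}"
  have S: "\<Union>P = S"
  proof
    show "S \<subseteq> \<Union>P"
    proof
      fix a assume a: "a \<in> S"
      then obtain b where "{a, b} \<in> D" using assms(1) TL_partner by blast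
      then have "{a, b} \<in> P" using closed a unfolding P_def by auto
      then show "a \<in> \<Union>P" by blast
    qed
  qed (auto simp: P_def)
  have two: "card l = 2" if "l \<in> P" for l
    using TL that unfolding TL_diagrams_def P_def by auto
  have "card (\<Union>P) = (\<Sum>l\<in>P. card l)"
  proof (rule card_Union_disjoint)
    show "pairwise disjnt P"
      using TL_same_line unfolding pairwise_def disjnt_def P_def by blast
    show "\<And>l. l \<in> P \<Longrightarrow> finite l" using two by (metis card.infinite zero_neq_numeral)
  qed
  also have "\<dots> = (\<Sum>l\<in>P. 2)" by (rule sum.cong) (use two in auto)
  finally show ?thesis using S by simp
qed

end

lemma finite_TL: "D \<in> TL_diagrams N \<Longrightarrow> finite D"
  using finite_elements[OF finite_nodes[of N], of D] by (simp add: TL_diagrams_def)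

lemma TL_subset_eq:
  assumes "D \<in> TL_diagrams N" "D' \<in> TL_diagrams N" "D \<subseteq> D'"
  shows "D = D'"
proof
  show "D' \<subseteq> D"
  proof
    fix l assume l: "l \<in> D'"
    then obtain a b where ab: "l = {a, b}" using TL_lineE[OF assms(2)] by metis
    then have "a \<in> nodes N" using TL_ends[OF assms(2)] l by blast
    then obtain c where "{a, c} \<in> D" using TL_partner[OF assms(1)] by blast
    then show "l \<in> D" using TL_unique[OF assms(2), of a b c] l ab assms(3) by auto
  qed
qed fact

section \<open>The identity and the generators as noncrossing pairings; finiteness of the set of
  blob diagrams\<close>

lemma id_lines_TL: "id_lines N \<in> TL_diagrams N"
proof (rule TL_I)
  fix a assume "a \<in> nodes N"
  then show "\<exists>l\<in>id_lines N. a \<in> l" by (cases a) (auto simp: id_lines_def)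
next
  \<comment> \<open>A constant sum of the two positions makes any two lines nested, never
    interleaved.\<close>
  have sum: "pos N a + pos N b = 2 * N + 1" if "{a, b} \<in> id_lines N" for a b
    using that by (auto simp: id_lines_def doubleton_eq_iff)
  show False if "{a, c} \<in> id_lines N" "{b, d} \<in> id_lines N" "pos N a < pos N b" "pos N c < pos N d"
    for a b c d
    using sum[OF that(1)] sum[OF that(2)] that(3,4) by simp
next
  show "\<exists>a\<in>nodes N. \<exists>b\<in>nodes N. a \<noteq> b \<and> l = {a, b}" if "l \<in> id_lines N" for l
    using that unfolding id_lines_def by (force intro: bexI)
  show "l = l'" if "l \<in> id_lines N" "l' \<in> id_lines N" "a \<in> l" "a \<in> l'" for l l' a
    using that unfolding id_lines_def by auto
qed

lemma cup_cap_TL: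
  assumes "1 \<le> k" "k < N"
  shows "cup_cap N k \<in> TL_diagrams N"
proof (rule TL_I)
  fix a assume "a \<in> nodes N"
  then show "\<exists>l\<in>cup_cap N k. a \<in> l"
    unfolding cup_cap_def by (cases a) (simp_all, blast+)
next
  fix l assume "l \<in> cup_cap N k"
  then consider "l = {North k, North (k + 1)}" | "l = {South k, South (k + 1)}"
    | j where "j \<in> {1..N}" "l = {North j, South j}"
    unfolding cup_cap_def by blast
  then show "\<exists>a\<in>nodes N. \<exists>b\<in>nodes N. a \<noteq> b \<and> l = {a, b}"
  proof cases
    case 1 with assms show ?thesis by (intro bexI[of _ "North k"] bexI[of _ "North (k + 1)"]) auto
  next
    case 2 with assms show ?thesis by (intro bexI[of _ "South k"] bexI[of _ "South (k + 1)"]) auto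
  next
    case 3 then show ?thesis by (intro bexI[of _ "North j"] bexI[of _ "South j"]) auto
  qed
next
  \<comment> \<open>A line with adjacent ends has nothing strictly between them and cannot
    interleave; two lines with the same position sum are nested.\<close>
  have sum: "pos N a + pos N b = 2 * N + 1 \<or> pos N a = pos N b + 1 \<or> pos N b = pos N a + 1"
    if "{a, b} \<in> cup_cap N k" for a b
    using that assms by (auto simp: cup_cap_def doubleton_eq_iff)
  show False if "{a, c} \<in> cup_cap N k" "{b, d} \<in> cup_cap N k"
    "pos N a < pos N b" "pos N b < pos N c" "pos N c < pos N d" for a b c d
    using sum[OF that(1)] sum[OF that(2)] that(3-5) by linarith
next
  show "l = l'" if "l \<in> cup_cap N k" "l' \<in> cup_cap N k" "a \<in> l" "a \<in> l'" for l l' a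
  proof -
    \<comment> \<open>\<open>f\<close> sends a node to the line it must lie on, so two lines with a
      common node coincide.\<close>
    define f where "f = case_node
      (\<lambda>j. if j \<in> {k, k + 1} then {North k, North (k + 1)} else {North j, South j})
      (\<lambda>j. if j \<in> {k, k + 1} then {South k, South (k + 1)} else {North j, South j})"
    have f: "L = f a" if "L \<in> cup_cap N k" "a \<in> L" for L
      using that unfolding cup_cap_def f_def by (elim UnE) (auto split: node.splits)
    show ?thesis using f[OF that(1,3)] f[OF that(2,4)] by simp
  qed
qed

lemma blob_diagram_iff:
  "(D, B) \<in> blob_diagrams n \<longleftrightarrow> D \<in> TL_diagrams n \<and> B \<subseteq> D \<and>
    (\<forall>l\<in>B. \<forall>a\<in>l. \<not> (\<exists>c d. {c, d} \<in> D \<and> pos n c < pos n a \<and> pos n a < pos n d))"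
proof (cases "D \<in> TL_diagrams n")
  case True
  have "exposed n D l \<longleftrightarrow>
    l \<in> D \<and> (\<forall>a\<in>l. \<not> (\<exists>c d. {c, d} \<in> D \<and> pos n c < pos n a \<and> pos n a < pos n d))"
    for l
  proof (cases "l \<in> D")
    case l: True
    then obtain a b where "l = {a, b}" using TL_lineE[OF True] by metis
    then have "a \<in> l" by simp
    then show ?thesis using l exposed_iff[OF True l] by blast
  qed (simp add: exposed_def)
  then have "{l. exposed n D l} = {l \<in> D. \<forall>a\<in>l. \<not> (\<exists>c d. {c, d} \<in> D \<and>
      pos n c < pos n a \<and> pos n a < pos n d)}" by blast
  then show ?thesis using True by (simp add: blob_diagrams_def) blast
qed (simp add: blob_diagrams_def)

lemma finite_blob_diagrams: "finite (blob_diagrams n)"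
proof (rule finite_subset)
  show "blob_diagrams n \<subseteq> Pow (Pow (nodes n)) \<times> Pow (Pow (nodes n))"
  proof (rule subrelI)
    fix D B assume "(D, B) \<in> blob_diagrams n"
    then have "\<Union>D = nodes n" "B \<subseteq> D"
      unfolding blob_diagram_iff TL_diagrams_def partition_on_def by auto
    then show "(D, B) \<in> Pow (Pow (nodes n)) \<times> Pow (Pow (nodes n))" by blast
  qed
qed simp

text \<open>There are only \<open>n\<close> admissible values. The upper bound propagates upwards
  from \<open>f 1\<close>, the lower bound downwards from \<open>f n\<close>, and they meet.\<close>

lemma strictly_decreasing_eq:
  fixes f :: "nat \<Rightarrow> nat"
  assumes dec: "\<And>j k. 1 \<le> j \<Longrightarrow> j < k \<Longrightarrow> k \<le> n \<Longrightarrow> f k < f j"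
    and range: "\<And>j. 1 \<le> j \<Longrightarrow> j \<le> n \<Longrightarrow> n < f j \<and> f j \<le> 2 * n"
    and j: "1 \<le> j" "j \<le> n"
  shows "f j = 2 * n + 1 - j"
proof -
  have "f j + j \<le> 2 * n + 1" using j
  proof (induction j rule: dec_induct)
    case base then show ?case using range[of 1] by simp
  next
    case (step k) then show ?case using dec[of k "Suc k"] by simp
  qed
  moreover have "2 * n + 1 \<le> f j + j" using j(2,1)
  proof (induction j rule: inc_induct)
    case base then show ?case using range[of n] by simp
  next
    case (step k) then show ?case using dec[of k "Suc k"] by simp
  qed
  ultimately show ?thesis by simp
qed

text \<open>If no line closes in the northern row, every northern node has a southern partner;
  noncrossing makes the partner positions strictly decreasing, which forces the identity. Otherwise
  the first closing position yields the cap. The last conclusion, that nothing closes up to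
  \<open>i\<close>, later shows that this cap carries no blob.\<close>

lemma first_cap:
  assumes TL: "D \<in> TL_diagrams n" and "D \<noteq> id_lines n"
  obtains i where "1 \<le> i" "i < n" "{North i, North (i + 1)} \<in> D"
    "\<And>a b. {a, b} \<in> D \<Longrightarrow> pos n a \<le> i \<Longrightarrow> pos n a < pos n b"
proof -
  \<comment> \<open>\<open>Q p\<close> says that a line closes at position \<open>p\<close>, that
    is, its other end comes earlier.\<close>
  define Q where "Q p \<longleftrightarrow> (\<exists>a b. {a, b} \<in> D \<and> pos n a < pos n b \<and> pos n b = p)" for p
  have "\<exists>p\<le>n. Q p"
  proof (rule ccontr)
    assume no: "\<not> ?thesis"
    have "\<forall>j\<in>{1..n}. \<exists>b. {North j, b} \<in> D"
      using TL_partner[OF TL] by (metis North_in_nodes atLeastAtMost_iff)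
    then obtain m where m: "\<And>j. 1 \<le> j \<Longrightarrow> j \<le> n \<Longrightarrow> {North j, m j} \<in> D"
      by (metis atLeastAtMost_iff)
    have opens: "j < pos n (m j)" and mn: "m j \<in> nodes n" if "1 \<le> j" "j \<le> n" for j
    proof -
      show "m j \<in> nodes n" using TL_ends[OF TL m[OF that]] by blast
      have "j \<noteq> pos n (m j)" using TL_ends[OF TL m[OF that]] that pos_eq_iff
        by (metis pos.simps(1))
      moreover have "\<not> pos n (m j) < j"
        using no m[OF that] that unfolding Q_def by (metis insert_commute pos.simps(1))
      ultimately show "j < pos n (m j)" by simp
    qed
    have large: "n < pos n (m j) \<and> pos n (m j) \<le> 2 * n" if "1 \<le> j" "j \<le> n" for j
    proof -
      have "\<not> pos n (m j) \<le> n"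
        using no m[OF that] opens[OF that] unfolding Q_def by (metis pos.simps(1))
      then show ?thesis using pos_range[OF mn[OF that]] by simp
    qed
    have "{North j, South j} \<in> D" if j: "1 \<le> j" "j \<le> n" for j
    proof -
      have "pos n (m j) = 2 * n + 1 - j"
      proof (rule strictly_decreasing_eq[of n "\<lambda>j. pos n (m j)"])
        fix j k assume jk: "1 \<le> j" "j < k" "k \<le> n"
        then show "pos n (m k) < pos n (m j)"
          using TL_nested[OF TL m[of j] m[of k]] large[of j] by auto
      qed (use large j in auto)
      then have "m j = South j" using mn[OF j] j pos_eq_iff[of "m j" n "South j"] by simp
      then show ?thesis using m[OF j] by simp
    qed
    then have "id_lines n \<subseteq> D" unfolding id_lines_def by auto
    then show False using TL_subset_eq[OF id_lines_TL TL] assms(2) by simp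
  qed
  then have ex: "\<exists>p. Q p" and "(LEAST p. Q p) \<le> n"
    using Least_le le_trans by blast+
  moreover define p where "p = (LEAST p. Q p)"
  ultimately have "Q p" "p \<le> n" and least: "\<And>k. k < p \<Longrightarrow> \<not> Q k"
    by (auto intro: LeastI_ex dest: not_less_Least)
  obtain a b where ab: "{a, b} \<in> D" "pos n a < pos n b" "pos n b = p"
    using \<open>Q p\<close> unfolding Q_def by blast
  note nodes = TL_ends[OF TL ab(1)]
  have p1: "1 \<le> pos n a" using pos_range nodes by blast
  have opens: "pos n c < pos n d" if "{c, d} \<in> D" "pos n c < p" for c d
  proof -
    have "\<not> pos n d < pos n c" using least that unfolding Q_def by (metis insert_commute)
    moreover have "pos n d \<noteq> pos n c" using TL_ends[OF TL that(1)] pos_eq_iff by metis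
    ultimately show ?thesis by simp
  qed
  \<comment> \<open>If the closed line were longer, the node just before \<open>p\<close> would lie
    under it and its partner would too. By minimality of \<open>p\<close> that partner comes later,
    but there is no room before \<open>p\<close>.\<close>
  have a: "pos n a = p - 1"
  proof (rule ccontr)
    assume *: "pos n a \<noteq> p - 1"
    obtain c where c: "c \<in> nodes n" "pos n c = p - 1"
    proof (rule pos_surj)
      show "1 \<le> p - 1" "p - 1 \<le> 2 * n" using ab p1 \<open>p \<le> n\<close> by linarith+
    qed
    obtain d where "{c, d} \<in> D" using TL_partner[OF TL c(1)] by blast
    moreover have "pos n a < pos n c" "pos n c < pos n b" "pos n c < p" using c * ab by linarith+
    ultimately show False using TL_nested[OF TL ab(1), of c d] opens[of c d] c(2) ab(3) by linarith
  qed
  have "a = North (p - 1)"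
    using pos_eq_iff[of a n "North (p - 1)"] nodes a p1 \<open>p \<le> n\<close> by auto
  moreover have "b = North p"
    using pos_eq_iff[of b n "North p"] nodes ab p1 \<open>p \<le> n\<close> by auto
  ultimately show ?thesis
    using that[of "p - 1"] ab p1 \<open>p \<le> n\<close> a opens by auto
qed

section \<open>Removing a cap\<close>

fun column :: "node \<Rightarrow> nat" where
  "column (North i) = i"
| "column (South i) = i"

text \<open>The west half of the frame is the mirror image of the east half, and a line with a blob
  stands for two lines that cross the axis. The line crossing the vertical between the columns
  \<open>i\<close> and \<open>i + 1\<close> next after the cap \<open>{North i, North (i + 1)}\<close> is found by parity.\<close>

lemma next_crossing:
  assumes DB: "(D, B) \<in> blob_diagrams n" and i: "1 \<le> i" "i < n"
    and cap: "{North i, North (i + 1)} \<in> D"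
  obtains a b where "{a, b} \<in> D" "i + 1 < pos n b" "i + 1 \<le> column b" "{a, b} \<in> B \<or> column a \<le> i"
    "\<And>c d. {c, d} \<in> D \<Longrightarrow> i + 1 < pos n c \<Longrightarrow> pos n c < pos n b \<Longrightarrow>
      {c, d} \<notin> B \<and> i + 1 < pos n d \<and> pos n d < pos n b"
proof -
  have TL: "D \<in> TL_diagrams n" and "B \<subseteq> D"
    and exposed: "\<And>l a c d. l \<in> B \<Longrightarrow> a \<in> l \<Longrightarrow> {c, d} \<in> D \<Longrightarrow> pos n c < pos n a \<Longrightarrow> \<not> pos n a < pos n d"
    using DB unfolding blob_diagram_iff by blast+
  \<comment> \<open>These are the nodes after \<open>North (i + 1)\<close> in the columns beyond
    \<open>i\<close>: position \<open>2 * n - i\<close> is \<open>South (i + 1)\<close>. Their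
    number \<open>2 * (n - i) - 1\<close> is odd, so some line leaves \<open>R\<close>. A blob line
    counts as leaving, since its unfolded copies cross the axis.\<close>
  define R where "R = {c \<in> nodes n. i + 2 \<le> pos n c \<and> pos n c \<le> 2 * n - i}"
  define Q where "Q c \<longleftrightarrow> c \<in> R \<and> (\<exists>d. {c, d} \<in> D \<and> ({c, d} \<in> B \<or> d \<notin> R))" for c
  have "card R = card {i + 2..2 * n - i}"
    unfolding R_def by (rule card_nodes_between) auto
  also have "\<dots> = 2 * (n - i) - 1" using i by simp
  finally have "odd (card R)" using i by simp
  then have "\<exists>c. Q c"
    using TL_even_card[OF TL, of R] unfolding Q_def R_def by blast
  then obtain b where b: "Q b" and "\<And>c. Q c \<Longrightarrow> pos n b \<le> pos n c"
    using ex_has_least_nat[of Q _ "pos n"] by blast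
  then have least: "\<And>c. pos n c < pos n b \<Longrightarrow> \<not> Q c" by (meson not_le)
  then obtain a where ba: "{b, a} \<in> D" "{b, a} \<in> B \<or> a \<notin> R" and R: "b \<in> R"
    using b unfolding Q_def by blast
  note nodes = TL_ends[OF TL ba(1)]
  show ?thesis
  proof (rule that)
    show "{a, b} \<in> D" using ba by (simp add: insert_commute)
    show "i + 1 < pos n b" using R by (simp add: R_def)
    show "i + 1 \<le> column b" using R i by (cases b) (auto simp: R_def)
    show "{a, b} \<in> B \<or> column a \<le> i"
    proof (cases "{b, a} \<in> B")
      case False
      then have "a \<notin> R" using ba by simp
      moreover have "a \<noteq> North (i + 1)"
      proof
        assume "a = North (i + 1)"
        then have "b = North i"
          using TL_unique[OF TL, of a b "North i"] ba cap by (simp add: insert_commute)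
        then show False using R by (simp add: R_def)
      qed
      ultimately show ?thesis using nodes by (cases a) (auto simp: R_def)
    qed (simp add: insert_commute)
    fix c d assume cd: "{c, d} \<in> D" "i + 1 < pos n c" "pos n c < pos n b"
    then have c: "c \<in> R" using R TL_ends[OF TL cd(1)] by (auto simp: R_def)
    then have d: "{c, d} \<notin> B" "d \<in> R" using least[OF cd(3)] cd(1) unfolding Q_def by blast+
    have "pos n d < pos n b"
    proof (rule ccontr)
      assume *: "\<not> ?thesis"
      show False
      proof (cases "d = b")
        case True
        then have "{b, c} \<in> D" using cd(1) by (simp add: insert_commute)
        then have "a = c" using TL_unique[OF TL ba(1)] by simp
        then show False using ba(2) c d(1) True by (simp add: insert_commute)
      next
        \<comment> \<open>Here the line of \<open>c\<close> encloses \<open>b\<close>, hence also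
          \<open>a\<close>. So \<open>a\<close> stays in \<open>R\<close>, and the line of
          \<open>b\<close> can qualify for \<open>Q\<close> only by its blob; but it is not
          exposed.\<close>
        case False
        then have b: "pos n b < pos n d"
          using * TL_ends[OF TL cd(1)] nodes pos_eq_iff[of b n d] by auto
        have "pos n c < pos n a \<and> pos n a < pos n d"
          using TL_nested[OF TL cd(1) ba(1) cd(3) b] .
        then have "a \<in> R" using c d(2) nodes by (auto simp: R_def)
        then have "{b, a} \<in> B" using ba(2) by simp
        then show False using exposed[of "{b, a}" b c d] cd b by simp
      qed
    qed
    then show "{c, d} \<notin> B \<and> i + 1 < pos n d \<and> pos n d < pos n b"
      using d by (simp add: R_def)
  qed
qed

text \<open>The diagram \<open>(D, B)\<close> is the product of \<open>U\<^sub>i\<close> and \<open>(D', B')\<close>. The conditions on the columns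
  make \<open>(D', B')\<close> the shorter diagram.\<close>

locale cap_removal =
  fixes n i :: nat and a b :: node and D\<^sub>0 B\<^sub>0 :: "node set set" and blob :: bool
  fixes D B D' B' :: "node set set"
  defines "D \<equiv> insert {North i, North (i + 1)} (insert {a, b} D\<^sub>0)"
    and "B \<equiv> if blob then insert {a, b} B\<^sub>0 else B\<^sub>0"
    and "D' \<equiv> insert {North i, a} (insert {North (i + 1), b} D\<^sub>0)"
    and "B' \<equiv> if blob then insert {North i, a} B\<^sub>0 else B\<^sub>0"
  assumes i: "1 \<le> i" "i < n"
    and D: "(D, B) \<in> blob_diagrams n"
    and D': "(D', B') \<in> blob_diagrams n"
    and B\<^sub>0: "B\<^sub>0 \<subseteq> D\<^sub>0"
    and D\<^sub>0: "\<And>l. l \<in> D\<^sub>0 \<Longrightarrow> North i \<notin> l \<and> North (i + 1) \<notin> l \<and> a \<notin> l \<and> b \<notin> l"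
    and ab: "a \<in> nodes n" "b \<in> nodes n" "a \<noteq> b" "North i \<noteq> a" "North i \<noteq> b" "North (i + 1) \<noteq> a"
      "North (i + 1) \<noteq> b"
    and column: "i + 1 \<le> column b" "blob \<or> column a \<le> i"

text \<open>The cap and the line \<open>{a, b}\<close> exchange partners. By \<open>closed'\<close>,
  lines with an end strictly between \<open>North (i + 1)\<close> and \<open>b\<close> stay there,
  so the new line \<open>{North (i + 1), b}\<close> is not crossed. The stretch between
  \<open>North i\<close> and \<open>a\<close> is composed of this stretch and the one between
  \<open>a\<close> and \<open>b\<close>, neither of which an old line leaves.\<close>

lemma uncrossed_swap:
  assumes TL: "D \<in> TL_diagrams n" and i: "1 \<le> i" "i < n" and cap: "{North i, North (i + 1)} \<in> D"
    and ab: "{a, b} \<in> D" "i + 1 < pos n b"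
    and closed': "\<forall>c d. {c, d} \<in> D \<longrightarrow> i + 1 < pos n c \<longrightarrow> pos n c < pos n b \<longrightarrow>
      i + 1 < pos n d \<and> pos n d < pos n b"
    and D\<^sub>0_def: "D\<^sub>0 = D - {{North i, North (i + 1)}, {a, b}}"
  shows "insert {North i, a} (insert {North (i + 1), b} D\<^sub>0) \<in> TL_diagrams n" (is "?D \<in> _")
    and "\<And>l. l \<in> D\<^sub>0 \<Longrightarrow> North i \<notin> l \<and> North (i + 1) \<notin> l \<and> a \<notin> l \<and> b \<notin> l"
    and "a \<noteq> b" "North i \<noteq> a" "North i \<noteq> b" "North (i + 1) \<noteq> a" "North (i + 1) \<noteq> b"
    and "\<not> (i + 1 < pos n a \<and> pos n a < pos n b)" "a \<in> nodes n" "b \<in> nodes n"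
proof -
  note closed = closed'[rule_format]
  note ends = TL_ends[OF TL ab(1)]
  then show nodes: "a \<in> nodes n" "b \<in> nodes n" and "a \<noteq> b" by auto
  show neq: "North i \<noteq> b" "North (i + 1) \<noteq> b" using ab(2) by auto
  show neqa: "North i \<noteq> a" "North (i + 1) \<noteq> a"
    using TL_unique[OF TL, of a b] ab cap neq by (metis insert_commute)+
  show na: "\<not> (i + 1 < pos n a \<and> pos n a < pos n b)"
    using closed[OF ab(1)] by auto
  show D\<^sub>0: "North i \<notin> l \<and> North (i + 1) \<notin> l \<and> a \<notin> l \<and> b \<notin> l" if "l \<in> D\<^sub>0" for l
    using TL_same_line[OF TL _ cap, of l] TL_same_line[OF TL _ ab(1), of l] that unfolding D\<^sub>0_def by auto
  show "?D \<in> TL_diagrams n"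
  proof (rule TL_I)
    fix l assume "l \<in> ?D"
    then consider "l = {North i, a}" | "l = {North (i + 1), b}" | "l \<in> D" unfolding D\<^sub>0_def by blast
    then show "\<exists>a\<in>nodes n. \<exists>b\<in>nodes n. a \<noteq> b \<and> l = {a, b}"
    proof cases
      case 1 then show ?thesis using nodes neqa i by (intro bexI[of _ "North i"] bexI[of _ a]) auto
    next
      case 2 then show ?thesis using nodes neq i by (intro bexI[of _ "North (i + 1)"] bexI[of _ b]) auto
    next
      case 3 then show ?thesis using TL_lineE[OF TL] TL_ends[OF TL] by metis
    qed
  next
    fix c assume "c \<in> nodes n"
    then obtain l where "l \<in> D" "c \<in> l" using TL_cover[OF TL] by blast
    then consider "c = North i \<or> c = a" | "c = North (i + 1) \<or> c = b" | "l \<in> D\<^sub>0" "c \<in> l"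
      unfolding D\<^sub>0_def by auto
    then show "\<exists>l\<in>?D. c \<in> l" by cases auto
  next
    fix l l' c assume "l \<in> ?D" "l' \<in> ?D" "c \<in> l" "c \<in> l'"
    moreover have "l = l'" if "l \<in> D\<^sub>0" "l' \<in> D\<^sub>0"
      using that \<open>c \<in> l\<close> \<open>c \<in> l'\<close> TL_same_line[OF TL] unfolding D\<^sub>0_def by blast
    ultimately show "l = l'" using D\<^sub>0[of l] D\<^sub>0[of l'] neq neqa \<open>a \<noteq> b\<close> by auto
  next
    fix p q r s
    assume pr: "{p, r} \<in> ?D" and qs: "{q, s} \<in> ?D"
      and less: "pos n p < pos n q" "pos n q < pos n r" "pos n r < pos n s"
    \<comment> \<open>Lines are unordered, so both orders of the ends of each new line are
      listed.\<close>
    define fresh where "fresh c d \<longleftrightarrow> c = North i \<and> d = a \<or> c = a \<and> d = North i \<or>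
        c = North (i + 1) \<and> d = b \<or> c = b \<and> d = North (i + 1)" for c d
    have new: "{c, d} \<in> D\<^sub>0 \<or> fresh c d"
      if "{c, d} \<in> ?D" for c d
      using that unfolding fresh_def by (metis doubleton_eq_iff insertE)
    have pa: "pos n a \<noteq> i" "pos n a \<noteq> i + 1"
      using pos_eq_iff[OF nodes(1), of "North i"] pos_eq_iff[OF nodes(1), of "North (i + 1)"] neqa i by auto
    have old1: "{c, d} \<in> D \<and> pos n c \<noteq> i \<and> pos n c \<noteq> i + 1 \<and> pos n c \<noteq> pos n a \<and> pos n c \<noteq> pos n b \<and>
        (i + 1 < pos n c \<and> pos n c < pos n b \<longrightarrow> i + 1 < pos n d \<and> pos n d < pos n b) \<and>
        (pos n a < pos n c \<and> pos n c < pos n b \<longrightarrow> pos n a < pos n d \<and> pos n d < pos n b) \<and>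
        (pos n b < pos n c \<and> pos n c < pos n a \<longrightarrow> pos n b < pos n d \<and> pos n d < pos n a)"
      if "{c, d} \<in> D\<^sub>0" for c d
    proof -
      have cd: "{c, d} \<in> D" using that unfolding D\<^sub>0_def by blast
      then have "c \<in> nodes n" using TL_ends[OF TL] by blast
      then have "pos n c \<noteq> pos n (North i)" "pos n c \<noteq> pos n (North (i + 1))" "pos n c \<noteq> pos n a"
          "pos n c \<noteq> pos n b"
        using pos_eq_iff[of c n "North i"] pos_eq_iff[of c n "North (i + 1)"] pos_eq_iff[of c n a]
          pos_eq_iff[of c n b] nodes i D\<^sub>0[OF that] by auto
      then show ?thesis
        using cd closed[OF cd] TL_nested[OF TL ab(1) cd] TL_nested[OF TL _ cd, of b a] ab(1)
        by (simp add: insert_commute)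
    qed
    define between where "between x y z \<longleftrightarrow> x < z \<and> z < y \<or> y < z \<and> z < x" for x y z :: nat
    have position: "pos n a < i \<or> pos n b < pos n a"
      using na pa pos_eq_iff[OF nodes] \<open>a \<noteq> b\<close> by linarith
    \<comment> \<open>With the four ends set aside, the stretch between \<open>North i\<close> and
      \<open>a\<close> is a difference of the two uncrossed stretches if \<open>a\<close> lies
      before \<open>North i\<close>, and their union if \<open>a\<close> lies after
      \<open>b\<close>.\<close>
    have fresh_a: "between i (pos n a) x \<longleftrightarrow>
        (if pos n a < i then between (pos n a) (pos n b) x \<and> \<not> between (i + 1) (pos n b) x
         else between (i + 1) (pos n b) x \<or> between (pos n a) (pos n b) x)"
      if "x \<noteq> i" "x \<noteq> i + 1" "x \<noteq> pos n a" "x \<noteq> pos n b" for x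
      using that position ab(2) unfolding between_def by auto
    have "fresh p r \<Longrightarrow> {c, d} \<in> D\<^sub>0 \<Longrightarrow>
        between (pos n p) (pos n r) (pos n c) \<longleftrightarrow> between (pos n p) (pos n r) (pos n d)" for p r c d
    proof -
      assume "fresh p r" and cd: "{c, d} \<in> D\<^sub>0"
      then have dc: "{d, c} \<in> D\<^sub>0" by (simp add: insert_commute)
      note old = old1[OF cd] old1[OF dc]
      have "\<not> (pos n b < x \<and> x < i + 1)" for x using ab(2) by linarith
      then have old': "between (i + 1) (pos n b) (pos n c) \<longleftrightarrow> between (i + 1) (pos n b) (pos n d)"
        unfolding between_def using old by blast
      have old'': "between (pos n a) (pos n b) (pos n c) \<longleftrightarrow> between (pos n a) (pos n b) (pos n d)"
        unfolding between_def using old by blast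
      have comm: "between x y z \<longleftrightarrow> between y x z" for x y z unfolding between_def by blast
      have "between i (pos n a) (pos n c) \<longleftrightarrow> between i (pos n a) (pos n d)"
        using fresh_a[of "pos n c"] fresh_a[of "pos n d"] old old' old'' by presburger
      then show ?thesis
        using \<open>fresh p r\<close> old' comm unfolding fresh_def by auto
    qed
    then have sep: "fresh p r \<Longrightarrow> {c, d} \<in> D\<^sub>0 \<Longrightarrow> between (pos n p) (pos n r) (pos n c) \<Longrightarrow>
        between (pos n p) (pos n r) (pos n d)" for p r c d by blast
    consider "{p, r} \<in> D\<^sub>0" "{q, s} \<in> D\<^sub>0" | "{p, r} \<in> D\<^sub>0" "fresh q s"
      | "{q, s} \<in> D\<^sub>0" "fresh p r" | "fresh p r" "fresh q s"
      using new[OF pr] new[OF qs] by blast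
    then show False
    proof cases
      case 1
      then have "{p, r} \<in> D" "{q, s} \<in> D" unfolding D\<^sub>0_def by auto
      from TL_nested[OF TL this less(1,2)] less(3) show False by simp
    next
      case 2
      then have "{r, p} \<in> D\<^sub>0" by (simp add: insert_commute)
      from sep[OF 2(2) this] less show False unfolding between_def by linarith
    next
      case 3
      from sep[OF 3(2,1)] less show False unfolding between_def by linarith
    next
      \<comment> \<open>Two distinct new lines lie side by side if \<open>a\<close> comes before
        \<open>North i\<close>, and are nested if \<open>a\<close> comes after
        \<open>b\<close>.\<close>
      case 4
      with less position ab(2) show False
        unfolding fresh_def by (elim disjE conjE) simp_all
    qed
  qed
qed

text \<open>A blob on \<open>{a, b}\<close> must go to exactly one of the two new lines, or a second
  blob would meet it. The line at \<open>North i\<close> is the right one: the other may be enclosed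
  by it. What remains to check is that all blobs are still exposed.\<close>

lemma cap_removal_exists:
  assumes DB: "(D, B) \<in> blob_diagrams n" and i: "1 \<le> i" "i < n"
    and cap: "{North i, North (i + 1)} \<in> D" "{North i, North (i + 1)} \<notin> B"
  obtains a b D\<^sub>0 B\<^sub>0 blob where "cap_removal n i a b D\<^sub>0 B\<^sub>0 blob"
    "D = insert {North i, North (i + 1)} (insert {a, b} D\<^sub>0)"
    "B = (if blob then insert {a, b} B\<^sub>0 else B\<^sub>0)"
proof -
  obtain a b where ab: "{a, b} \<in> D" "i + 1 < pos n b"
    and column: "i + 1 \<le> column b" "{a, b} \<in> B \<or> column a \<le> i"
    and closed: "\<And>c d. {c, d} \<in> D \<Longrightarrow> i + 1 < pos n c \<Longrightarrow> pos n c < pos n b \<Longrightarrow>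
      {c, d} \<notin> B \<and> i + 1 < pos n d \<and> pos n d < pos n b"
    using next_crossing[OF DB i cap(1)] by metis
  have TL: "D \<in> TL_diagrams n" and "B \<subseteq> D"
    and exposed: "\<And>l a c d. l \<in> B \<Longrightarrow> a \<in> l \<Longrightarrow> {c, d} \<in> D \<Longrightarrow> pos n c < pos n a \<Longrightarrow> \<not> pos n a < pos n d"
    using DB unfolding blob_diagram_iff by blast+
  define D\<^sub>0 where "D\<^sub>0 = D - {{North i, North (i + 1)}, {a, b}}"
  define B\<^sub>0 where "B\<^sub>0 = B - {{a, b}}"
  define blob where "blob \<longleftrightarrow> {a, b} \<in> B"
  have closed': "\<forall>c d. {c, d} \<in> D \<longrightarrow> i + 1 < pos n c \<longrightarrow> pos n c < pos n b \<longrightarrow>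
      i + 1 < pos n d \<and> pos n d < pos n b"
    using closed by blast
  note swap = uncrossed_swap[OF TL i cap(1) ab closed' D\<^sub>0_def]
  have D: "D = insert {North i, North (i + 1)} (insert {a, b} D\<^sub>0)"
    using cap ab unfolding D\<^sub>0_def by blast
  have B: "B = (if blob then insert {a, b} B\<^sub>0 else B\<^sub>0)"
    unfolding blob_def B\<^sub>0_def by auto
  have sub: "B\<^sub>0 \<subseteq> D\<^sub>0"
    using \<open>B \<subseteq> D\<close> cap(2) unfolding D\<^sub>0_def B\<^sub>0_def by blast
  let ?D = "insert {North i, a} (insert {North (i + 1), b} D\<^sub>0)"
  let ?B = "if blob then insert {North i, a} B\<^sub>0 else B\<^sub>0"
  have "(?D, ?B) \<in> blob_diagrams n"
    unfolding blob_diagram_iff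
  proof (intro conjI ballI notI)
    show "?D \<in> TL_diagrams n" by (rule swap(1))
    show "?B \<subseteq> ?D" using sub by auto
    fix l e assume l: "l \<in> ?B" and e: "e \<in> l"
      and "\<exists>c d. {c, d} \<in> ?D \<and> pos n c < pos n e \<and> pos n e < pos n d"
    then obtain c d where cd: "{c, d} \<in> ?D" "pos n c < pos n e" "pos n e < pos n d" by blast
    have pa: "pos n a \<noteq> i" "pos n a \<noteq> i + 1"
      using pos_eq_iff[OF swap(9), of "North i"] pos_eq_iff[OF swap(9), of "North (i + 1)"]
        swap(4,6) i by auto
    show False
    proof (cases "l \<in> B\<^sub>0")
      case True
      then have lB: "l \<in> B" and lD: "l \<in> D\<^sub>0" using sub unfolding B\<^sub>0_def by auto
      then have "l \<in> D" unfolding D\<^sub>0_def by blast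
      obtain f where f: "l = {e, f}"
        using TL_lineE[OF TL \<open>l \<in> D\<close>] e by (metis insert_commute insertE singletonD)
      have en: "e \<in> nodes n" using TL_ends[OF TL] \<open>l \<in> D\<close> f by blast
      have ne: "pos n e \<noteq> i" "pos n e \<noteq> i + 1" "pos n e \<noteq> pos n a" "pos n e \<noteq> pos n b"
        using pos_eq_iff[OF en, of "North i"] pos_eq_iff[OF en, of "North (i + 1)"]
          pos_eq_iff[OF en, of a] pos_eq_iff[OF en, of b] swap(9,10) swap(2)[OF lD] i e by auto
      \<comment> \<open>The choice of \<open>b\<close> as the first crossing leaves no blob strictly
        between \<open>North (i + 1)\<close> and \<open>b\<close>.\<close>
      have outside: "\<not> (i + 1 < pos n e \<and> pos n e < pos n b)"
        using closed[of e f] lB \<open>l \<in> D\<close> unfolding f by blast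
      have nb: "\<not> (pos n a < pos n e \<and> pos n e < pos n b)" "\<not> (pos n b < pos n e \<and> pos n e < pos n a)"
        using exposed[OF lB e, of a b] exposed[OF lB e, of b a] ab(1) by (auto simp: insert_commute)
      have "{c, d} \<in> D\<^sub>0"
      proof -
        consider "{c, d} \<in> D\<^sub>0" | "c = North i" "d = a" | "c = a" "d = North i"
          | "c = North (i + 1)" "d = b" | "c = b" "d = North (i + 1)"
          using cd(1) by (metis doubleton_eq_iff insertE)
        then show ?thesis
        proof cases
          case 2
          then have "i < pos n e" "pos n e < pos n a" using cd by auto
          then show ?thesis using outside ne ab(2) nb by linarith
        next
          case 3
          then have "pos n a < pos n e" "pos n e < i" using cd by auto
          then show ?thesis using ab(2) nb by linarith
        next
          case 4
          then show ?thesis using cd outside by simp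
        next
          case 5
          then show ?thesis using cd ab(2) by simp
        qed
      qed
      then show False using exposed[OF lB e, of c d] cd unfolding D\<^sub>0_def by blast
    next
      case False
      then have blob: "{a, b} \<in> B" and l: "l = {North i, a}" using l by (auto simp: blob_def split: if_splits)
      have not_a: "\<not> (pos n c < pos n a \<and> pos n a < pos n d)"
        and not_b: "\<not> (pos n c < pos n b \<and> pos n b < pos n d)" if "{c, d} \<in> D\<^sub>0"
        using exposed[OF blob, of a c d] exposed[OF blob, of b c d] that unfolding D\<^sub>0_def by auto
      show False
      proof (cases "{c, d} \<in> D\<^sub>0")
        case True
        \<comment> \<open>An old line around \<open>a\<close> would already have hidden the blob on
          \<open>{a, b}\<close>. One around \<open>North i\<close> must end after
          \<open>North (i + 1)\<close>: ending before \<open>b\<close> it would leave an uncrossed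
          stretch, and ending after \<open>b\<close> it would hide that blob as well.\<close>
        then have "e = North i" using not_a cd l e by blast
        moreover have "{d, c} \<in> D" using True unfolding D\<^sub>0_def by (auto simp: insert_commute)
        moreover have "d \<in> nodes n" using TL_ends[OF TL \<open>{d, c} \<in> D\<close>] by blast
        then have "pos n d \<noteq> i + 1" "pos n d \<noteq> pos n b"
          using pos_eq_iff[of d n "North (i + 1)"] pos_eq_iff[of d n b] swap(2)[OF True] swap(10) i
          by auto
        ultimately show False
          using closed[of d c] not_b[OF True] cd ab(2) i by auto
      next
        case False
        then show False
          using cd e l swap(8) ab(2) pa by (auto simp: doubleton_eq_iff)
      qed
    qed
  qed
  then have "cap_removal n i a b D\<^sub>0 B\<^sub>0 blob"
    using i DB sub swap(2-7,9,10) column unfolding cap_removal_def D[symmetric] B[symmetric]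
    by (simp add: blob_def)
  then show ?thesis using that D B by blast
qed

section \<open>Stacking a generator on a diagram\<close>

text \<open>Half the number of verticals between neighbouring columns that the unfolded line
  crosses. A plain line has two copies, each spanning its column difference. A blob line becomes two
  lines joining columns \<open>x\<close> and \<open>y\<close> to their mirror images, which cross
  \<open>2 * x - 1\<close> and \<open>2 * y - 1\<close> verticals.\<close>

definition line_length :: "node set set \<Rightarrow> node set \<Rightarrow> nat" where
  "line_length B l = (if l \<in> B then sum column l - 1 else Max (column ` l) - Min (column ` l))"

definition diagram_length :: "blob_diagram \<Rightarrow> nat" where
  "diagram_length d = sum (line_length (snd d)) (fst d)"

lemma line_length_blob: "{a, b} \<in> B \<Longrightarrow> a \<noteq> b \<Longrightarrow> line_length B {a, b} = column a + column b - 1"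
  by (simp add: line_length_def)

lemma line_length_plain:
  "{a, b} \<notin> B \<Longrightarrow> column a \<le> column b \<Longrightarrow> line_length B {a, b} = column b - column a"
  by (simp add: line_length_def)

context cap_removal
begin

lemma finite_D\<^sub>0: "finite D\<^sub>0"
proof -
  have "finite D" using D finite_TL unfolding blob_diagram_iff by blast
  then show ?thesis unfolding D_def by simp
qed

lemma notin_D\<^sub>0: "{North i, x} \<notin> D\<^sub>0" "{North (i + 1), x} \<notin> D\<^sub>0" "{a, x} \<notin> D\<^sub>0"
  using D\<^sub>0 by blast+

lemma column_pos: "1 \<le> column a" "1 \<le> column b"
  using ab(1,2) by (cases a, auto) (cases b, auto)

lemma D_distinct: "{North i, North (i + 1)} \<noteq> {a, b}"
  and D'_distinct: "{North i, a} \<noteq> {North (i + 1), b}"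
  using ab by (auto simp: doubleton_eq_iff)

lemma notin_blobs: "{North i, North (i + 1)} \<notin> B" "{North (i + 1), b} \<notin> B'"
    "{North i, a} \<in> B' \<longleftrightarrow> blob" "{a, b} \<in> B \<longleftrightarrow> blob"
  using D_distinct D'_distinct notin_D\<^sub>0 B\<^sub>0 unfolding B_def B'_def by (auto simp: subset_iff)

text \<open>The length drops by exactly 2, with or without a blob: one unit for the cap and one for
  the crossing between the columns \<open>i\<close> and \<open>i + 1\<close> that is cut
  out.\<close>

lemma diagram_length_less: "diagram_length (D', B') < diagram_length (D, B)"
proof -
  have same: "line_length B l = line_length B' l" if "l \<in> D\<^sub>0" for l
  proof -
    have "l \<in> B \<longleftrightarrow> l \<in> B'" using that notin_D\<^sub>0 unfolding B_def B'_def by auto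
    then show ?thesis by (simp add: line_length_def)
  qed
  have sum: "diagram_length (D, B) = line_length B {North i, North (i + 1)} + line_length B {a, b} +
      sum (line_length B') D\<^sub>0"
    using finite_D\<^sub>0 notin_D\<^sub>0 D_distinct same by (simp add: diagram_length_def D_def cong: sum.cong)
  have sum': "diagram_length (D', B') = line_length B' {North i, a} + line_length B' {North (i + 1), b} +
      sum (line_length B') D\<^sub>0"
    using finite_D\<^sub>0 notin_D\<^sub>0 D'_distinct by (simp add: diagram_length_def D'_def)
  have b: "line_length B' {North (i + 1), b} = column b - (i + 1)"
    using line_length_plain[OF notin_blobs(2)] column by simp
  have cap: "line_length B {North i, North (i + 1)} = 1"
    using line_length_plain[OF notin_blobs(1)] by simp
  show ?thesis
  proof (cases blob)
    case True
    then have "line_length B' {North i, a} = i + column a - 1"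
        "line_length B {a, b} = column a + column b - 1"
      using line_length_blob[of "North i" a B'] line_length_blob[of a b B] notin_blobs(3,4) ab by auto
    then show ?thesis unfolding sum sum' b cap using column(1) column_pos by linarith
  next
    case False
    then have "line_length B' {North i, a} = i - column a"
        "line_length B {a, b} = column b - column a"
      using line_length_plain[of a "North i" B'] line_length_plain[of a b B] column notin_blobs(3,4)
      by (auto simp: insert_commute)
    then show ?thesis unfolding sum sum' b cap using column(1,2) column_pos False by linarith
  qed
qed

end

section \<open>Strands of a stacked picture\<close>

lemma mem_joined_iff: "(x, y) \<in> joined d1 d2 \<longleftrightarrow>
    (\<exists>l\<in>fst d1. x \<in> upper ` l \<and> y \<in> upper ` l) \<or> (\<exists>l\<in>fst d2. x \<in> lower ` l \<and> y \<in> lower ` l)"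
  unfolding joined_def by blast

lemma sym_joined: "sym (joined d1 d2)"
  unfolding sym_def mem_joined_iff by blast

text \<open>Closed blocks contain whole components, and connected blocks lie within one. Since
  \<open>joined\<close> is symmetric, connectedness may be given by paths from all members to one
  root.\<close>

lemma strands_eqI:
  assumes cover: "\<Union>P = Top ` {1..n} \<union> Middle ` {1..n} \<union> Bottom ` {1..n}" and "{} \<notin> P"
    and closed: "\<And>C u v. C \<in> P \<Longrightarrow> u \<in> C \<Longrightarrow> (u, v) \<in> joined d1 d2 \<Longrightarrow> v \<in> C"
    and connected: "\<And>C. C \<in> P \<Longrightarrow> \<exists>r. \<forall>u\<in>C. (u, r) \<in> (joined d1 d2)\<^sup>*"
  shows "strands n d1 d2 = P"
proof -
  have component: "(joined d1 d2)\<^sup>* `` {v} = C" if C: "C \<in> P" and v: "v \<in> C" for C v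
  proof
    show "(joined d1 d2)\<^sup>* `` {v} \<subseteq> C"
    proof
      fix u assume "u \<in> (joined d1 d2)\<^sup>* `` {v}"
      then have "(v, u) \<in> (joined d1 d2)\<^sup>*" by simp
      then show "u \<in> C" by (induction rule: rtrancl_induct) (use v C closed in blast)+
    qed
    show "C \<subseteq> (joined d1 d2)\<^sup>* `` {v}"
    proof
      fix u assume u: "u \<in> C"
      obtain r where r: "\<forall>u\<in>C. (u, r) \<in> (joined d1 d2)\<^sup>*" using connected[OF C] by blast
      have "(r, u) \<in> (joined d1 d2)\<^sup>*"
        using symD[OF sym_rtrancl[OF sym_joined]] r u by blast
      with bspec[OF r v] have "(v, u) \<in> (joined d1 d2)\<^sup>*" by (rule rtrancl_trans)
      then show "u \<in> (joined d1 d2)\<^sup>* `` {v}" by simp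
    qed
  qed
  let ?V = "Top ` {1..n} \<union> Middle ` {1..n} \<union> Bottom ` {1..n}"
  show ?thesis
  proof
    show "P \<subseteq> strands n d1 d2"
    proof
      fix C assume C: "C \<in> P"
      then have "C \<noteq> {}" using \<open>{} \<notin> P\<close> by blast
      then obtain v where v: "v \<in> C" by blast
      then have "v \<in> ?V" using C cover by blast
      then have "(joined d1 d2)\<^sup>* `` {v} \<in> strands n d1 d2" unfolding strands_def by (rule imageI)
      then show "C \<in> strands n d1 d2" using component[OF C v] by simp
    qed
    show "strands n d1 d2 \<subseteq> P"
    proof
      fix C assume "C \<in> strands n d1 d2"
      then obtain v where "v \<in> ?V" and C: "C = (joined d1 d2)\<^sup>* `` {v}" unfolding strands_def by (rule imageE)
      then obtain C' where "C' \<in> P" "v \<in> C'" using cover by blast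
      then show "C \<in> P" using component C by simp
    qed
  qed
qed

lemma inj_lower: "inj lower"
proof (rule injI)
  fix x y assume "lower x = lower y"
  then show "x = y" by (cases x; cases y) auto
qed

lemma lower_eq [simp]: "lower x \<noteq> Top j" "Top j \<noteq> lower x"
    "lower x = Middle j \<longleftrightarrow> x = North j" "Middle j = lower x \<longleftrightarrow> x = North j"
    "lower x = Bottom j \<longleftrightarrow> x = South j" "Bottom j = lower x \<longleftrightarrow> x = South j"
  by (cases x; auto)+

lemma lower_image_nodes: "lower ` nodes n = Middle ` {1..n} \<union> Bottom ` {1..n}"
  by (simp add: nodes_def image_Un image_image)

text \<open>The vertices of a line of the lower diagram and the ends of the through lines \<open>{North j, South j}\<close>,
  \<open>j \<notin> I\<close>, attached to it from above.\<close>

definition strand :: "nat set \<Rightarrow> node set \<Rightarrow> vertex set" where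
  "strand I l = lower ` l \<union> {Top j | j. North j \<in> l \<and> j \<notin> I}"

lemma mem_strand [simp]:
  "lower x \<in> strand I l \<longleftrightarrow> x \<in> l"
  "Top j \<in> strand I l \<longleftrightarrow> North j \<in> l \<and> j \<notin> I"
  "Middle j \<in> strand I l \<longleftrightarrow> North j \<in> l"
  "Bottom j \<in> strand I l \<longleftrightarrow> South j \<in> l"
  unfolding strand_def by (auto simp: image_iff inj_eq[OF inj_lower])

lemma lower_image_subset_strand: "lower ` l' \<subseteq> strand I l \<longleftrightarrow> l' \<subseteq> l"
  by auto

lemma Union_strand: "\<Union>D = nodes n \<Longrightarrow>
  \<Union>(strand I ` D) = Top ` ({1..n} - I) \<union> Middle ` {1..n} \<union> Bottom ` {1..n}"
proof -
  assume D: "\<Union>D = nodes n"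
  have "\<Union>(strand I ` D) = lower ` \<Union>D \<union> {Top j | j. North j \<in> \<Union>D \<and> j \<notin> I}"
    unfolding strand_def by auto
  then show ?thesis unfolding D lower_image_nodes by auto
qed

lemma outer_Un: "outer (C \<union> C') = outer C \<union> outer C'"
  unfolding outer_def by auto

lemma outer_strand: "outer (strand I l) = l - North ` I"
proof -
  have "x \<in> outer (strand I l) \<longleftrightarrow> x \<in> l - North ` I" for x by (cases x) (auto simp: outer_def)
  then show ?thesis by blast
qed

lemma strand_subset_connected:
  assumes l: "l \<in> fst d2" "x \<in> l" and "u \<in> strand I l"
    and through: "\<And>j. 1 \<le> j \<Longrightarrow> j \<le> n \<Longrightarrow> j \<notin> I \<Longrightarrow> {North j, South j} \<in> fst d1"
    and nodes: "l \<subseteq> nodes n"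
  shows "(u, lower x) \<in> (joined d1 d2)\<^sup>*"
proof -
  have low: "(lower y, lower x) \<in> joined d1 d2" if "y \<in> l" for y
    using l that unfolding mem_joined_iff by blast
  consider y where "u = lower y" "y \<in> l" | j where "u = Top j" "North j \<in> l" "j \<notin> I"
    using assms(3) unfolding strand_def by blast
  then show ?thesis
  proof cases
    case 1 then show ?thesis using low by blast
  next
    case 2
    then have "{North j, South j} \<in> fst d1" using through nodes by auto
    moreover have "Top j \<in> upper ` {North j, South j}" "Middle j \<in> upper ` {North j, South j}" by simp_all
    ultimately have "(Top j, Middle j) \<in> joined d1 d2" unfolding mem_joined_iff by blast
    moreover have "(Middle j, lower x) \<in> joined d1 d2" using low[OF 2(2)] by simp
    ultimately show ?thesis unfolding 2(1) by (meson r_into_rtrancl rtrancl.rtrancl_into_rtrancl)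
  qed
qed

lemma lower_line_strand:
  assumes "D \<in> TL_diagrams n" "l \<in> D" "l' \<in> D" "u \<in> strand I l" "u \<in> lower ` l'" "v \<in> lower ` l'"
  shows "v \<in> strand I l"
proof -
  obtain x where "x \<in> l'" "x \<in> l" using assms(4,5) by auto
  then have "l' = l" using TL_same_line[OF assms(1)] assms(2,3) by blast
  then show ?thesis using assms(6) by auto
qed

section \<open>Stacking \<open>e\<close> on a diagram whose leftmost blob has been removed\<close>

context
  fixes n :: nat and D B :: "node set set" and c :: node and d1 d2 :: blob_diagram
  assumes DB: "(D, B) \<in> blob_diagrams n" and n: "1 \<le> n" and c: "{North 1, c} \<in> B"
    and d1: "d1 = (id_lines n, {{North 1, South 1}})" and d2: "d2 = (D, B - {{North 1, c}})"
begin

lemma strands_e: "strands n d1 d2 = strand {} ` D"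
proof (rule strands_eqI)
  have TL: "D \<in> TL_diagrams n" using DB unfolding blob_diagram_iff by blast
  then have un: "\<Union>D = nodes n" unfolding TL_diagrams_def partition_on_def by blast
  show "\<Union>(strand {} ` D) = Top ` {1..n} \<union> Middle ` {1..n} \<union> Bottom ` {1..n}"
    using Union_strand[OF un] by simp
  show "{} \<notin> strand {} ` D"
    using TL unfolding strand_def TL_diagrams_def partition_on_def by auto
  fix C assume "C \<in> strand {} ` D"
  then obtain l where l: "l \<in> D" "C = strand {} l" by blast
  obtain x y where "l = {x, y}" using TL_lineE[OF TL l(1)] by metis
  then have "(u, lower x) \<in> (joined d1 d2)\<^sup>*" if "u \<in> C" for u
    using strand_subset_connected[of l d2 x u "{}" n d1] l that un by (auto simp: id_lines_def d1 d2)
  then show "\<exists>r. \<forall>u\<in>C. (u, r) \<in> (joined d1 d2)\<^sup>*" by blast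
  fix u v assume u: "u \<in> C" and "(u, v) \<in> joined d1 d2"
  then consider l' where "l' \<in> id_lines n" "u \<in> upper ` l'" "v \<in> upper ` l'"
    | l' where "l' \<in> D" "u \<in> lower ` l'" "v \<in> lower ` l'"
    unfolding mem_joined_iff d1 d2 fst_conv by blast
  then show "v \<in> C"
  proof cases
    case 1
    then show ?thesis using u l by (auto simp: id_lines_def)
  next
    case 2
    then show ?thesis using lower_line_strand[OF TL l(1)] u l by blast
  qed
qed

text \<open>The blob of \<open>e\<close> lands on the strand through \<open>Top 1\<close>, exactly
  the one whose blob was removed, so no strand collects two blobs.\<close>

lemma blob_count_e:
  assumes l: "l \<in> D"
  shows "blob_count d1 d2 (strand {} l) = (if l \<in> B then 1 else 0)"
proof -
  have TL: "D \<in> TL_diagrams n" and BD: "B \<subseteq> D" using DB unfolding blob_diagram_iff by blast+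
  have 1: "l = {North 1, c}" if "North 1 \<in> l" using TL_same_line[OF TL l _ that] c BD by blast
  have eq: "l' = l" if "l' \<in> B" "l' \<subseteq> l" for l'
  proof -
    have "l' \<in> D" using that BD by blast
    then obtain x y where "l' = {x, y}" using TL_lineE[OF TL] by metis
    then show ?thesis using TL_same_line[OF TL \<open>l' \<in> D\<close> l, of x] that by blast
  qed
  have "{l' \<in> {{North 1, South 1}}. upper ` l' \<subseteq> strand {} l} = (if North 1 \<in> l then {{North 1, South 1}} else {})"
    by auto
  moreover have "{l' \<in> B - {{North 1, c}}. lower ` l' \<subseteq> strand {} l} = (B - {{North 1, c}}) \<inter> {l}"
    using eq unfolding lower_image_subset_strand by auto
  ultimately have count: "blob_count d1 d2 (strand {} l) =
      card (if North 1 \<in> l then {{North 1, South 1}} else {} :: node set set) + card ((B - {{North 1, c}}) \<inter> {l})"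
    unfolding blob_count_def d1 d2 snd_conv by simp
  show ?thesis
  proof (cases "North 1 \<in> l")
    case True
    then have "l \<in> B" "(B - {{North 1, c}}) \<inter> {l} = {}" using 1 c by auto
    then show ?thesis unfolding count using True by simp
  next
    case False
    then have "(B - {{North 1, c}}) \<inter> {l} = B \<inter> {l}" by blast
    then show ?thesis unfolding count using False by simp
  qed
qed

lemma stack_e: "stack n d1 d2 = (D, B)"
proof -
  have TL: "D \<in> TL_diagrams n" and BD: "B \<subseteq> D" using DB unfolding blob_diagram_iff by blast+
  then have "{} \<notin> D" unfolding TL_diagrams_def partition_on_def by auto
  then have "{C \<in> strands n d1 d2. outer C \<noteq> {}} = strand {} ` D"
    "{C \<in> strands n d1 d2. outer C \<noteq> {} \<and> blob_count d1 d2 C > 0} = strand {} ` B"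
    using BD by (auto simp: strands_e blob_count_e outer_strand split: if_splits)
  then show ?thesis by (simp add: stack_def image_image outer_strand)
qed

lemma stack_factor_e: "stack_factor n q \<gamma> \<delta> d1 d2 = 1"
proof -
  have "{} \<notin> D" using DB unfolding blob_diagram_iff TL_diagrams_def partition_on_def by auto
  then show ?thesis
    unfolding stack_factor_def by (intro prod.neutral) (auto simp: strands_e blob_count_e outer_strand)
qed

lemma blob_diagram_remove_e: "d2 \<in> blob_diagrams n"
  using DB unfolding d2 blob_diagram_iff by blast

text \<open>With one end in column 1, the line has length \<open>column c\<close> with its blob and
  \<open>column c - 1\<close> without.\<close>

lemma diagram_length_e: "diagram_length d2 < diagram_length (D, B)"
proof -
  have TL: "D \<in> TL_diagrams n" and BD: "B \<subseteq> D" using DB unfolding blob_diagram_iff by blast+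
  have fin: "finite D" using finite_TL[OF TL] .
  have l: "{North 1, c} \<in> D" using c BD by blast
  have cn: "1 \<le> column c" "North 1 \<noteq> c" using TL_ends[OF TL l] by (cases c; auto)+
  have same: "line_length B l' = line_length (B - {{North 1, c}}) l'" if "l' \<in> D - {{North 1, c}}" for l'
    using that by (simp add: line_length_def)
  have "line_length (B - {{North 1, c}}) {North 1, c} < line_length B {North 1, c}"
    using line_length_plain[of "North 1" c] line_length_blob[OF c cn(2)] cn by simp
  then show ?thesis
    unfolding diagram_length_def d2 fst_conv snd_conv sum.remove[OF fin l]
    by (subst sum.cong[OF refl same]) auto
qed

end

section \<open>Stacking a generator on the diagram with the cap removed\<close>

context cap_removal
begin

context
  fixes d1 d2 :: blob_diagram and I :: "nat set" and T\<^sub>0 C\<^sub>0 :: "vertex set"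
  assumes d1: "d1 = (cup_cap n i, {})" and d2: "d2 = (D', B')" and I: "I = {i, i + 1}"
    and T\<^sub>0: "T\<^sub>0 = {Top i, Top (i + 1)}"
    and C\<^sub>0: "C\<^sub>0 = strand I {North i, a} \<union> strand I {North (i + 1), b}"
begin

text \<open>The southern arc of the generator glues the lines at \<open>North i\<close> and
  \<open>North (i + 1)\<close> into the strand \<open>C\<^sub>0\<close> with outer ends
  \<open>a\<close> and \<open>b\<close>; its northern arc is the strand \<open>T\<^sub>0\<close>;
  all other lines are merely prolonged. Every strand reaches the outer frame, so there is no
  loop.\<close>

lemma strands_U: "strands n d1 d2 = insert T\<^sub>0 (insert C\<^sub>0 (strand I ` D\<^sub>0))"
proof (rule strands_eqI)
  have TL: "D' \<in> TL_diagrams n" using D' unfolding blob_diagram_iff by blast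
  then have un: "\<Union>D' = nodes n" unfolding TL_diagrams_def partition_on_def by blast
  have "\<Union>(insert T\<^sub>0 (insert C\<^sub>0 (strand I ` D\<^sub>0))) = T\<^sub>0 \<union> \<Union>(strand I ` D')"
    unfolding D'_def C\<^sub>0 by auto
  then show "\<Union>(insert T\<^sub>0 (insert C\<^sub>0 (strand I ` D\<^sub>0))) = Top ` {1..n} \<union> Middle ` {1..n} \<union> Bottom ` {1..n}"
    unfolding Union_strand[OF un] T\<^sub>0 I using i by auto
  have ne: "{} \<notin> D'" using TL unfolding TL_diagrams_def partition_on_def by blast
  show "{} \<notin> insert T\<^sub>0 (insert C\<^sub>0 (strand I ` D\<^sub>0))"
    using ne unfolding strand_def D'_def T\<^sub>0 C\<^sub>0 by auto
  have conn: "(u, lower x) \<in> (joined d1 d2)\<^sup>*" if "l \<in> D'" "u \<in> strand I l" "x \<in> l" for u l x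
    using strand_subset_connected[of l d2 x u I n d1] that un by (auto simp: cup_cap_def d1 d2 I)
  fix C assume "C \<in> insert T\<^sub>0 (insert C\<^sub>0 (strand I ` D\<^sub>0))"
  then consider (cap) "C = T\<^sub>0" | (cut) "C = C\<^sub>0" | (old) l where "l \<in> D\<^sub>0" "C = strand I l"
    by blast
  note C = this
  from C show "\<exists>r. \<forall>u\<in>C. (u, r) \<in> (joined d1 d2)\<^sup>*"
  proof cases
    case cap
    have "{North i, North (i + 1)} \<in> fst d1" by (simp add: cup_cap_def d1)
    moreover have "Top i \<in> upper ` {North i, North (i + 1)}" "Top (i + 1) \<in> upper ` {North i, North (i + 1)}"
      by simp_all
    ultimately have "(Top (i + 1), Top i) \<in> joined d1 d2" unfolding mem_joined_iff by blast
    then show ?thesis using cap T\<^sub>0 by auto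
  next
    case cut
    have "{South i, South (i + 1)} \<in> fst d1" by (simp add: cup_cap_def d1)
    moreover have "Middle i \<in> upper ` {South i, South (i + 1)}" "Middle (i + 1) \<in> upper ` {South i, South (i + 1)}"
      by simp_all
    ultimately have "(Middle (i + 1), Middle i) \<in> joined d1 d2" unfolding mem_joined_iff by blast
    moreover have "(u, Middle i) \<in> (joined d1 d2)\<^sup>*" if "u \<in> strand I {North i, a}" for u
      using conn[of "{North i, a}" u "North i"] that unfolding D'_def by simp
    moreover have "(u, Middle (i + 1)) \<in> (joined d1 d2)\<^sup>*" if "u \<in> strand I {North (i + 1), b}" for u
      using conn[of "{North (i + 1), b}" u "North (i + 1)"] that unfolding D'_def by simp
    ultimately have "\<forall>u\<in>C. (u, Middle i) \<in> (joined d1 d2)\<^sup>*"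
      unfolding cut C\<^sub>0 by (meson UnE rtrancl.rtrancl_into_rtrancl)
    then show ?thesis by blast
  next
    case old
    then have l: "l \<in> D'" unfolding D'_def by simp
    obtain x y where "l = {x, y}" using TL_lineE[OF TL l] by metis
    then show ?thesis using conn[OF l, of _ x] old by auto
  qed
  fix u v assume u: "u \<in> C" and "(u, v) \<in> joined d1 d2"
  then consider l' where "l' \<in> cup_cap n i" "u \<in> upper ` l'" "v \<in> upper ` l'"
    | l' where "l' \<in> D'" "u \<in> lower ` l'" "v \<in> lower ` l'"
    unfolding mem_joined_iff d1 d2 fst_conv by blast
  then show "v \<in> C"
  proof cases
    case 1
    then consider (top) "{u, v} \<subseteq> T\<^sub>0" | (middle) "{u, v} \<subseteq> {Middle i, Middle (i + 1)}"
      | (through) j where "{u, v} \<subseteq> {Top j, Middle j}" "j \<notin> I"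
      unfolding cup_cap_def I T\<^sub>0 by auto
    then show ?thesis
    proof cases
      case top
      then have "u = Top i \<or> u = Top (i + 1)" unfolding T\<^sub>0 by auto
      then have "u \<notin> strand I l" for l unfolding I by auto
      then show ?thesis using C u top unfolding C\<^sub>0 by blast
    next
      case middle
      then have "u = Middle i \<or> u = Middle (i + 1)" by auto
      then have "u \<notin> T\<^sub>0" "u \<notin> strand I l" if "l \<in> D\<^sub>0" for l using D\<^sub>0[OF that] unfolding T\<^sub>0 by auto
      moreover have "u \<notin> T\<^sub>0" using middle unfolding T\<^sub>0 by auto
      moreover have "v \<in> C\<^sub>0" using middle unfolding C\<^sub>0 by auto
      ultimately show ?thesis using C u by blast
    next
      case through
      then have "u \<notin> T\<^sub>0" unfolding T\<^sub>0 I by auto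
      moreover have "v \<in> strand I l" if "u \<in> strand I l" for l
        using that through by auto
      moreover from C have "C = C\<^sub>0 \<or> (\<exists>l. C = strand I l)" if "C \<noteq> T\<^sub>0" by cases (use that in auto)
      \<comment> \<open>A straight line of the generator carries membership from
        \<open>Top j\<close> to \<open>Middle j\<close> and back, for the glued strand as for a
        single one.\<close>
      ultimately show ?thesis using u unfolding C\<^sub>0 by blast
    qed
  next
    case 2
    have keep: "v \<in> strand I l" if "l \<in> D'" "u \<in> strand I l" for l
      using lower_line_strand[OF TL that(1) 2(1) that(2) 2(2,3)] .
    moreover have "u \<notin> T\<^sub>0" using 2 unfolding T\<^sub>0 by auto
    ultimately have "v \<in> C" if "C = strand I l" "l \<in> D'" for l using that u by blast
    moreover have "v \<in> C\<^sub>0" if "u \<in> C\<^sub>0"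
    proof -
      have "{North i, a} \<in> D'" "{North (i + 1), b} \<in> D'" unfolding D'_def by blast+
      then show ?thesis using that keep unfolding C\<^sub>0 by blast
    qed
    moreover have "D\<^sub>0 \<subseteq> D'" unfolding D'_def by blast
    moreover note \<open>u \<notin> T\<^sub>0\<close>
    ultimately show ?thesis using u by (cases rule: C) auto
  qed
qed

lemma blob_count_cap: "blob_count d1 d2 T\<^sub>0 = 0"
proof -
  have "\<not> lower ` l \<subseteq> T\<^sub>0" if "l \<in> B'" for l
  proof -
    have "l \<noteq> {}" using that D' unfolding blob_diagram_iff TL_diagrams_def partition_on_def by blast
    then show ?thesis unfolding T\<^sub>0 by auto
  qed
  then have "{l \<in> B'. lower ` l \<subseteq> T\<^sub>0} = {}" by blast
  then show ?thesis unfolding blob_count_def d1 d2 snd_conv by (simp only: card.empty) simp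
qed

lemma subset_line: "l' \<in> B' \<Longrightarrow> l \<in> D' \<Longrightarrow> x \<in> l' \<Longrightarrow> x \<in> l \<Longrightarrow> l' = l"
  using TL_same_line[of D' n l' l x] D' unfolding blob_diagram_iff by blast

lemma blob_line_ne: "l' \<in> B' \<Longrightarrow> l' \<noteq> {}"
  using D' unfolding blob_diagram_iff TL_diagrams_def partition_on_def by blast

lemma blob_count_old:
  assumes "l \<in> D\<^sub>0"
  shows "blob_count d1 d2 (strand I l) = (if l \<in> B\<^sub>0 then 1 else 0)"
proof -
  have "{l' \<in> B'. lower ` l' \<subseteq> strand I l} = B' \<inter> {l}"
    using subset_line[of _ l] blob_line_ne assms unfolding lower_image_subset_strand D'_def by blast
  moreover have "l \<in> B' \<longleftrightarrow> l \<in> B\<^sub>0" using assms notin_D\<^sub>0 unfolding B'_def by auto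
  ultimately show ?thesis unfolding blob_count_def d1 d2 by auto
qed

text \<open>Of the two lines glued together only the one at \<open>North i\<close> can carry a blob,
  so two blobs never meet.\<close>

lemma blob_count_cut: "blob_count d1 d2 C\<^sub>0 = (if blob then 1 else 0)"
proof -
  have "l' = {North i, a} \<or> l' = {North (i + 1), b}" if "l' \<in> B'" "l' \<subseteq> {North i, a} \<union> {North (i + 1), b}" for l'
    using subset_line[OF that(1), of "{North i, a}"] subset_line[OF that(1), of "{North (i + 1), b}"]
      blob_line_ne[OF that(1)] that(2) unfolding D'_def by blast
  moreover note notin_blobs(2,3)
  moreover have "lower ` l' \<subseteq> C\<^sub>0 \<longleftrightarrow> l' \<subseteq> {North i, a} \<union> {North (i + 1), b}" for l' unfolding C\<^sub>0 by auto
  ultimately have "{l' \<in> B'. lower ` l' \<subseteq> C\<^sub>0} = (if blob then {{North i, a}} else {})" by auto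
  then show ?thesis unfolding blob_count_def d1 d2 by simp
qed

lemma outer_cap: "outer T\<^sub>0 = {North i, North (i + 1)}"
  and outer_cut: "outer C\<^sub>0 = {a, b}"
  and outer_old: "l \<in> D\<^sub>0 \<Longrightarrow> outer (strand I l) = l" "l \<in> D\<^sub>0 \<Longrightarrow> l \<noteq> {}"
proof -
  show "outer T\<^sub>0 = {North i, North (i + 1)}" unfolding outer_def T\<^sub>0 by auto
  show "outer C\<^sub>0 = {a, b}" using ab unfolding outer_Un outer_strand C\<^sub>0 I by auto
  show "outer (strand I l) = l" if "l \<in> D\<^sub>0" using D\<^sub>0[OF that] unfolding outer_strand I by auto
  show "l \<noteq> {}" if "l \<in> D\<^sub>0"
    using that D' unfolding blob_diagram_iff TL_diagrams_def partition_on_def D'_def by blast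
qed

lemma stack_U: "stack n d1 d2 = (D, B)"
proof -
  have "{C \<in> strands n d1 d2. outer C \<noteq> {}} = insert T\<^sub>0 (insert C\<^sub>0 (strand I ` D\<^sub>0))"
    unfolding strands_U using outer_cap outer_cut outer_old by auto
  moreover have "{C \<in> strands n d1 d2. outer C \<noteq> {} \<and> blob_count d1 d2 C > 0} =
      (if blob then insert C\<^sub>0 (strand I ` B\<^sub>0) else strand I ` B\<^sub>0)"
    unfolding strands_U using outer_cap outer_cut outer_old B\<^sub>0 blob_count_cap blob_count_old blob_count_cut
    by (auto split: if_splits)
  moreover have "outer ` strand I ` D\<^sub>0 = D\<^sub>0" "outer ` strand I ` B\<^sub>0 = B\<^sub>0"
    using outer_old(1) B\<^sub>0 by (auto simp: image_image subset_iff image_iff)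
  ultimately show ?thesis
    by (simp add: stack_def D_def B_def outer_cap outer_cut)
qed

lemma stack_factor_U: "stack_factor n q \<gamma> \<delta> d1 d2 = 1"
  unfolding stack_factor_def
proof (intro prod.neutral ballI)
  fix C assume "C \<in> strands n d1 d2"
  then have "outer C \<noteq> {} \<and> blob_count d1 d2 C \<le> 1"
    unfolding strands_U using outer_cap outer_cut outer_old blob_count_cap blob_count_old blob_count_cut
    by auto
  then show "\<delta> ^ (blob_count d1 d2 C - 1) * (if outer C \<noteq> {} then 1
      else if blob_count d1 d2 C = 0 then q + unit_inv q else \<gamma>) = 1" by simp
qed

end

end

section \<open>Masks of the representing matrices\<close>

text \<open>The strand of the right (\<open>r = True\<close>) or left half in column \<open>j\<close>, columns being counted from
  the mirror axis, as an index of a word.\<close>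

definition half_index :: "nat \<Rightarrow> bool \<times> nat \<Rightarrow> nat" where
  "half_index n = (\<lambda>(r, j). if r then n + j - 1 else n - j)"

text \<open>Masks depend on letters only through equality and inequality, so the two letters are
  coded as truth values and inequality becomes negation.\<close>

definition half :: "nat \<Rightarrow> nat list \<Rightarrow> bool \<Rightarrow> nat \<Rightarrow> bool" where
  "half n v r j \<longleftrightarrow> v ! half_index n (r, j) = 1"

lemma bij_half_index: "bij_betw (half_index n) (UNIV \<times> {1..n}) {..<2 * n}"
proof (rule bij_betw_byWitness[where f' = "\<lambda>k. if k < n then (False, n - k) else (True, k + 1 - n)"])
qed (auto simp: half_index_def)

lemma words_eq_iff_half:
  assumes "v \<in> words (2 * n)" "w \<in> words (2 * n)" "1 \<le> j" "j \<le> n"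
  shows "v ! half_index n (r, j) = w ! half_index n (r, j) \<longleftrightarrow> half n v r j = half n w r j"
proof -
  have "half_index n (r, j) < 2 * n" using bij_betwE[OF bij_half_index, of n] assms by auto
  then have "v ! half_index n (r, j) \<in> {1, 2}" "w ! half_index n (r, j) \<in> {1, 2}"
    using assms(1,2) nth_mem[of "half_index n (r, j)"] unfolding words_def by force+
  then show ?thesis by (auto simp: half_def)
qed

lemma words_eqI:
  assumes v: "v \<in> words (2 * n)" and w: "w \<in> words (2 * n)"
    and eq: "\<And>r j. 1 \<le> j \<Longrightarrow> j \<le> n \<Longrightarrow> half n v r j = half n w r j"
  shows "v = w"
proof (rule nth_equalityI)
  show "length v = length w" using v w by (simp add: words_def)
  fix k assume "k < length v"
  then have "k \<in> half_index n ` (UNIV \<times> {1..n})"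
    using bij_betw_imp_surj_on[OF bij_half_index, of n] v by (simp add: words_def)
  then obtain r j where "k = half_index n (r, j)" "1 \<le> j" "j \<le> n" by auto
  then show "v ! k = w ! k" using words_eq_iff_half[OF v w] eq by blast
qed

lemma word_exists:
  "\<exists>u\<in>words (2 * n). \<forall>r j. 1 \<le> j \<longrightarrow> j \<le> n \<longrightarrow> half n u r j = h r j"
proof (intro bexI allI impI)
  define f where "f = inv_into (UNIV \<times> {1..n}) (half_index n)"
  define u where "u = map (\<lambda>k. if case_prod h (f k) then 1 else 2 :: nat) [0..<2 * n]"
  show "u \<in> words (2 * n)" by (auto simp: words_def u_def)
  fix r j assume j: "1 \<le> j" "j \<le> n"
  then have "half_index n (r, j) < 2 * n" using bij_betwE[OF bij_half_index, of n] by auto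
  moreover have "f (half_index n (r, j)) = (r, j)"
    unfolding f_def using j by (intro inv_into_f_f bij_betw_imp_inj_on[OF bij_half_index]) auto
  ultimately show "half n u r j = h r j" by (simp add: half_def u_def)
qed

section \<open>Zero patterns of the matrices of the generators\<close>

lemma prod_if_one_zero:
  "finite A \<Longrightarrow> (\<Prod>x\<in>A. if P x then 1 else 0) = (if \<forall>x\<in>A. P x then 1 else 0 :: 'k::comm_ring_1)"
  by (induction A rule: finite_induct) auto

lemma arc_weight_unit: "h dvd 1 \<Longrightarrow> a \<noteq> b \<Longrightarrow> arc_weight h a b dvd (1 :: 'k::comm_ring_1)"
proof -
  assume h: "h dvd 1" and "a \<noteq> b"
  then obtain k where k: "h * k = 1" by (metis dvdE)
  have "unit_inv h = k"
    unfolding unit_inv_def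
  proof (rule the_equality)
    fix b assume "h * b = 1"
    then show "b = k" using k by (metis mult.assoc mult.commute mult_1)
  qed (fact k)
  then have "unit_inv h dvd 1" using k by (metis dvdI mult.commute)
  then show ?thesis using h \<open>a \<noteq> b\<close> by (simp add: arc_weight_def)
qed

text \<open>The nonzero factors are units, so over any nontrivial commutative ring an entry vanishes
  only if one of its factors does.\<close>

lemma R_matrix_cup_cap_nonzero_iff:
  fixes h :: "'k::comm_ring_1"
  assumes h: "h dvd 1" and k: "1 \<le> k" "k < N"
  shows "R_matrix N h (cup_cap N k) v w \<noteq> 0 \<longleftrightarrow> v \<in> words N \<and> w \<in> words N \<and>
    v ! (k - 1) \<noteq> v ! k \<and> w ! (k - 1) \<noteq> w ! k \<and> (\<forall>j<N. j \<noteq> k - 1 \<longrightarrow> j \<noteq> k \<longrightarrow> v ! j = w ! j)"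
proof -
  have "{(i, j). i < j \<and> {North i, North j} \<in> cup_cap N k} = {(k, k + 1)}"
    and "{(i, j). i < j \<and> {South i, South j} \<in> cup_cap N k} = {(k, k + 1)}"
    and through: "{(i, j). {North i, South j} \<in> cup_cap N k} = (\<lambda>j. (j, j)) ` ({1..N} - {k, k + 1})"
    by (auto simp: cup_cap_def doubleton_eq_iff)
  moreover have "(\<Prod>(i, j)\<in>(\<lambda>j. (j, j)) ` ({1..N} - {k, k + 1}). if v ! (i - 1) = w ! (j - 1) then 1 else 0) =
      (if \<forall>j\<in>{1..N} - {k, k + 1}. v ! (j - 1) = w ! (j - 1) then 1 else 0 :: 'k)"
    by (subst prod.reindex) (auto simp: inj_on_def prod_if_one_zero)
  ultimately have R: "R_matrix N h (cup_cap N k) v w = (if v \<in> words N \<and> w \<in> words N then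
      arc_weight h (v ! (k - 1)) (v ! k) *
      (if \<forall>j\<in>{1..N} - {k, k + 1}. v ! (j - 1) = w ! (j - 1) then 1 else 0) *
      arc_weight h (w ! (k - 1)) (w ! k) else 0)"
    unfolding R_matrix_def by simp
  \<comment> \<open>Nodes are numbered from 1 and list entries from 0.\<close>
  have shift: "(\<forall>j\<in>{1..N} - {k, k + 1}. v ! (j - 1) = w ! (j - 1)) \<longleftrightarrow>
      (\<forall>j<N. j \<noteq> k - 1 \<longrightarrow> j \<noteq> k \<longrightarrow> v ! j = w ! j)"
  proof
    assume *: "\<forall>j\<in>{1..N} - {k, k + 1}. v ! (j - 1) = w ! (j - 1)"
    show "\<forall>j<N. j \<noteq> k - 1 \<longrightarrow> j \<noteq> k \<longrightarrow> v ! j = w ! j"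
    proof (intro allI impI)
      fix j assume "j < N" "j \<noteq> k - 1" "j \<noteq> k"
      then show "v ! j = w ! j" using bspec[OF *, of "j + 1"] by auto
    qed
  next
    assume *: "\<forall>j<N. j \<noteq> k - 1 \<longrightarrow> j \<noteq> k \<longrightarrow> v ! j = w ! j"
    show "\<forall>j\<in>{1..N} - {k, k + 1}. v ! (j - 1) = w ! (j - 1)"
    proof
      fix j assume "j \<in> {1..N} - {k, k + 1}"
      then have "j - 1 < N" "j - 1 \<noteq> k - 1" "j - 1 \<noteq> k" using k by auto
      then show "v ! (j - 1) = w ! (j - 1)" using * by blast
    qed
  qed
  have nz: "arc_weight h a b * arc_weight h c d \<noteq> 0 \<longleftrightarrow> a \<noteq> b \<and> c \<noteq> d" for a b c d
  proof (cases "a \<noteq> b \<and> c \<noteq> d")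
    case True
    then have "arc_weight h a b * arc_weight h c d dvd 1 * 1"
      using arc_weight_unit[OF h] by (intro mult_dvd_mono) auto
    then show ?thesis using True by auto
  qed (auto simp: arc_weight_def)
  show ?thesis unfolding R shift[symmetric] using nz by auto
qed

text \<open>Zero pattern of a generator on \<open>2 * n\<close> strands whose arcs join the strands
  \<open>x\<close> and \<open>y\<close>. Addressing strands by half and column lets one formula
  cover \<open>e\<close> on the axis and the two mirror factors of \<open>blob_U\<close>.\<close>

definition cap_mask :: "nat \<Rightarrow> bool \<times> nat \<Rightarrow> bool \<times> nat \<Rightarrow> nat list \<Rightarrow> nat list \<Rightarrow> bool" where
  "cap_mask n x y v w \<longleftrightarrow> v \<in> words (2 * n) \<and> w \<in> words (2 * n) \<and>
    case_prod (half n v) x \<noteq> case_prod (half n v) y \<and> case_prod (half n w) x \<noteq> case_prod (half n w) y \<and>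
    (\<forall>r j. 1 \<le> j \<longrightarrow> j \<le> n \<longrightarrow> (r, j) \<noteq> x \<longrightarrow> (r, j) \<noteq> y \<longrightarrow> half n v r j = half n w r j)"

lemma R_matrix_cap_mask:
  assumes h: "h dvd (1 :: 'k::comm_ring_1)" and k: "1 \<le> k" "k < 2 * n"
    and x: "x \<in> UNIV \<times> {1..n}" "half_index n x = k - 1" and y: "y \<in> UNIV \<times> {1..n}" "half_index n y = k"
  shows "R_matrix (2 * n) h (cup_cap (2 * n) k) v w \<noteq> 0 \<longleftrightarrow> cap_mask n x y v w"
proof (cases "v \<in> words (2 * n) \<and> w \<in> words (2 * n)")
  case True
  then have words: "v \<in> words (2 * n)" "w \<in> words (2 * n)" by auto
  have eq: "u ! (k - 1) = u ! k \<longleftrightarrow> case_prod (half n u) x = case_prod (half n u) y" if "u \<in> words (2 * n)" for u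
  proof -
    have "u ! (k - 1) \<in> set u" "u ! k \<in> set u" using that k by (auto simp: words_def)
    then have "u ! (k - 1) \<in> {1, 2}" "u ! k \<in> {1, 2}" using that unfolding words_def by blast+
    then show ?thesis using x(2) y(2) by (cases x; cases y) (auto simp: half_def)
  qed
  have "(\<forall>j<2 * n. j \<noteq> k - 1 \<longrightarrow> j \<noteq> k \<longrightarrow> v ! j = w ! j) \<longleftrightarrow>
      (\<forall>z\<in>UNIV \<times> {1..n}. z \<noteq> x \<longrightarrow> z \<noteq> y \<longrightarrow> v ! half_index n z = w ! half_index n z)"
  proof -
    have inj: "half_index n z = half_index n z' \<longleftrightarrow> z = z'" if "z \<in> UNIV \<times> {1..n}" "z' \<in> UNIV \<times> {1..n}" for z z'
      using inj_on_eq_iff[OF bij_betw_imp_inj_on[OF bij_half_index]] that by blast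
    have "half_index n z = k - 1 \<longleftrightarrow> z = x" "half_index n z = k \<longleftrightarrow> z = y" if "z \<in> UNIV \<times> {1..n}" for z
      using inj[OF that x(1)] inj[OF that y(1)] unfolding x(2) y(2) by blast+
    moreover have "(\<forall>j<2 * n. j \<noteq> k - 1 \<longrightarrow> j \<noteq> k \<longrightarrow> v ! j = w ! j) \<longleftrightarrow>
        (\<forall>j\<in>half_index n ` (UNIV \<times> {1..n}). j \<noteq> k - 1 \<longrightarrow> j \<noteq> k \<longrightarrow> v ! j = w ! j)"
      unfolding bij_betw_imp_surj_on[OF bij_half_index] lessThan_iff Ball_def ..
    ultimately show ?thesis by (simp cong: ball_cong)
  qed
  also have "\<dots> \<longleftrightarrow> (\<forall>r j. 1 \<le> j \<longrightarrow> j \<le> n \<longrightarrow> (r, j) \<noteq> x \<longrightarrow> (r, j) \<noteq> y \<longrightarrow> half n v r j = half n w r j)"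
    using words_eq_iff_half[OF words] by auto
  finally show ?thesis
    unfolding R_matrix_cup_cap_nonzero_iff[OF h k] cap_mask_def eq[OF words(1)] eq[OF words(2)]
    using words by simp
next
  case False
  then show ?thesis unfolding R_matrix_cup_cap_nonzero_iff[OF h k] cap_mask_def by blast
qed

section \<open>Products of matrices with known support and regular entries\<close>

definition has_mask :: "nat \<Rightarrow> 'k::comm_ring_1 word_matrix \<Rightarrow> (nat list \<Rightarrow> nat list \<Rightarrow> bool) \<Rightarrow> bool" where
  "has_mask N M P \<longleftrightarrow> M \<in> carrier (matrix_algebra N) \<and> regular_entries M \<and> (\<forall>v w. M v w \<noteq> 0 \<longleftrightarrow> P v w)"

lemma has_mask_words: "has_mask N M P \<Longrightarrow> P v w \<Longrightarrow> v \<in> words N \<and> w \<in> words N"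
  unfolding has_mask_def matrix_algebra_def by auto

lemma finite_words: "finite (words N)"
  using finite_lists_length_eq[of "{1, 2 :: nat}" N] by (simp add: words_def conj_commute)

text \<open>Two things could spoil the support of a product: cancellation within an entry, excluded
  by \<open>unique\<close>, and zero divisors, excluded by regularity. Regularity is inherited
  because the one remaining term is a product of two regular entries.\<close>

lemma has_mask_mult:
  assumes A: "has_mask N A P" and B: "has_mask N B Q"
    and unique: "\<And>v w u u'. P v u \<Longrightarrow> Q u w \<Longrightarrow> P v u' \<Longrightarrow> Q u' w \<Longrightarrow> u = u'"
    and PQ: "\<And>v w. (\<exists>u. P v u \<and> Q u w) \<longleftrightarrow> S v w"
  shows "has_mask N (A \<otimes>\<^bsub>matrix_algebra N\<^esub> B) S"
proof -
  let ?M = "A \<otimes>\<^bsub>matrix_algebra N\<^esub> B"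
  have M: "?M v w = (\<Sum>u\<in>words N. A v u * B u w)" for v w by (simp add: matrix_algebra_def)
  have zero: "?M v w = 0" if "\<not> S v w" for v w
  proof -
    have "A v u * B u w = 0" for u
    proof -
      have "A v u = 0 \<or> B u w = 0" using that PQ A B unfolding has_mask_def by metis
      then show ?thesis by auto
    qed
    then show ?thesis unfolding M by simp
  qed
  have entry: "\<exists>u. P v u \<and> Q u w \<and> ?M v w = A v u * B u w" if S: "S v w" for v w
  proof -
    obtain u where u: "P v u" "Q u w" using PQ S by blast
    have "A v u' * B u' w = 0" if "u' \<noteq> u" for u'
    proof -
      have "A v u' = 0 \<or> B u' w = 0" using unique[OF u] that A B unfolding has_mask_def by metis
      then show ?thesis by auto
    qed
    then have "?M v w = (\<Sum>u'\<in>{u}. A v u' * B u' w)"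
      unfolding M using has_mask_words[OF A u(1)] by (intro sum.mono_neutral_right finite_words) auto
    then show ?thesis using u by auto
  qed
  have regular: "c = 0" if S: "S v w" and c: "c * ?M v w = 0" for v w c
  proof -
    obtain u where u: "P v u" "Q u w" "?M v w = A v u * B u w" using entry[OF S] by blast
    have "A v u \<noteq> 0" "B u w \<noteq> 0" using u A B unfolding has_mask_def by blast+
    moreover have "(c * A v u) * B u w = 0" using c u(3) by (simp add: mult.assoc)
    ultimately show ?thesis using A B unfolding has_mask_def regular_entries_def by blast
  qed
  have nonzero: "?M v w \<noteq> 0 \<longleftrightarrow> S v w" for v w
    using zero regular[of v w 1] by auto
  moreover have "v \<in> words N \<and> w \<in> words N" if "S v w" for v w
    using that PQ has_mask_words[OF A] has_mask_words[OF B] by blast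
  then have "?M \<in> carrier (matrix_algebra N)" using zero by (auto simp: matrix_algebra_def)
  moreover have "regular_entries ?M" unfolding regular_entries_def nonzero using regular by blast
  ultimately show ?thesis unfolding has_mask_def by blast
qed

lemma has_mask_equiv:
  assumes "M \<in> carrier (matrix_algebra N)" "regular_entries M" "mask_equiv N M M'"
    and "\<And>v w. M' v w \<noteq> 0 \<longleftrightarrow> P v w" and "\<And>v w. P v w \<Longrightarrow> v \<in> words N \<and> w \<in> words N"
  shows "has_mask N M P"
  unfolding has_mask_def
proof (intro conjI allI)
  fix v w show "M v w \<noteq> 0 \<longleftrightarrow> P v w"
  proof (cases "v \<in> words N \<and> w \<in> words N")
    case True then show ?thesis using assms(3,4) unfolding mask_equiv_def by metis
  next
    case False then show ?thesis using assms(1,5) by (auto simp: matrix_algebra_def)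
  qed
qed (fact assms)+

text \<open>In \<open>R_matrix\<close> an arc demands different letters and a through line equal
  ones. Negating the southern letters turns both into the single demand that the two ends
  differ.\<close>

fun letter :: "nat \<Rightarrow> nat list \<Rightarrow> nat list \<Rightarrow> bool \<Rightarrow> node \<Rightarrow> bool" where
  "letter n v w r (North j) = half n v r j"
| "letter n v w r (South j) = (\<not> half n w r j)"

text \<open>The condition on the unfolded lines: a plain line is repeated in each half, while a blob
  line joins each of its ends to the mirror image of that end.\<close>

definition line_compatible :: "bool \<Rightarrow> (bool \<Rightarrow> node \<Rightarrow> bool) \<Rightarrow> node set \<Rightarrow> bool" where
  "line_compatible blob g l \<longleftrightarrow>
    (if blob then \<forall>x\<in>l. g True x \<noteq> g False x else \<forall>x\<in>l. \<forall>y\<in>l. x \<noteq> y \<longrightarrow> (\<forall>r. g r x \<noteq> g r y))"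

definition compatible :: "blob_diagram \<Rightarrow> (bool \<Rightarrow> node \<Rightarrow> bool) \<Rightarrow> bool" where
  "compatible d g \<longleftrightarrow> (\<forall>l\<in>fst d. line_compatible (l \<in> snd d) g l)"

definition diagram_mask :: "nat \<Rightarrow> blob_diagram \<Rightarrow> nat list \<Rightarrow> nat list \<Rightarrow> bool" where
  "diagram_mask n d v w \<longleftrightarrow> v \<in> words (2 * n) \<and> w \<in> words (2 * n) \<and> compatible d (letter n v w)"

lemma line_compatible_pair:
  "x \<noteq> y \<Longrightarrow> line_compatible blob g {x, y} \<longleftrightarrow>
    (if blob then g True x \<noteq> g False x \<and> g True y \<noteq> g False y else \<forall>r. g r x \<noteq> g r y)"
  by (auto simp: line_compatible_def)

lemma line_compatible_cong:
  "(\<And>x r. x \<in> l \<Longrightarrow> g r x = g' r x) \<Longrightarrow> line_compatible blob g l = line_compatible blob g' l"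
  unfolding line_compatible_def by auto

lemma letter_cong: "(\<And>j. x = North j \<Longrightarrow> half n u r j = half n v r j) \<Longrightarrow> letter n u w r x = letter n v w r x"
  by (cases x) auto

lemma has_mask_one: "has_mask (2 * n) \<one>\<^bsub>matrix_algebra (2 * n)\<^esub> (diagram_mask n (id_lines n, {}))"
  unfolding has_mask_def
proof (intro conjI allI)
  show "\<one>\<^bsub>matrix_algebra (2 * n)\<^esub> \<in> carrier (matrix_algebra (2 * n))"
    "regular_entries \<one>\<^bsub>matrix_algebra (2 * n)\<^esub>"
    by (auto simp: matrix_algebra_def regular_entries_def)
  fix v w
  have "id_lines n = (\<lambda>j. {North j, South j}) ` {1..n}" by (auto simp: id_lines_def)
  then have "compatible (id_lines n, {}) g \<longleftrightarrow>
      (\<forall>j\<in>{1..n}. line_compatible False g {North j, South j})" for g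
    by (simp add: compatible_def)
  then have "compatible (id_lines n, {}) (letter n v w) \<longleftrightarrow>
      (\<forall>j. 1 \<le> j \<longrightarrow> j \<le> n \<longrightarrow> (\<forall>r. half n v r j = half n w r j))"
    unfolding Ball_def atLeastAtMost_iff by (auto simp: line_compatible_pair)
  then show "\<one>\<^bsub>matrix_algebra (2 * n)\<^esub> v w \<noteq> 0 \<longleftrightarrow> diagram_mask n (id_lines n, {}) v w"
    using words_eqI[of v n w] by (auto simp: matrix_algebra_def diagram_mask_def)
qed

text \<open>The intermediate word agrees with \<open>v\<close> outside column 1. There the plain
  line \<open>{North 1, c}\<close> forces the opposite of the letters at \<open>c\<close>, in both
  halves, so the word is unique. The arc of \<open>e\<close> then turns the condition on column 1
  into the blob condition at \<open>c\<close>.\<close>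

lemma has_mask_e_step:
  assumes DB: "(D, B) \<in> blob_diagrams n" and n: "1 \<le> n" and c: "{North 1, c} \<in> B"
    and E: "has_mask (2 * n) E (cap_mask n (False, 1) (True, 1))"
    and M: "has_mask (2 * n) M (diagram_mask n (D, B - {{North 1, c}}))"
  shows "has_mask (2 * n) (E \<otimes>\<^bsub>matrix_algebra (2 * n)\<^esub> M) (diagram_mask n (D, B))"
proof (rule has_mask_mult[OF E M])
  have TL: "D \<in> TL_diagrams n" and BD: "B \<subseteq> D" using DB unfolding blob_diagram_iff by blast+
  have l: "{North 1, c} \<in> D" using c BD by blast
  have cn: "c \<in> nodes n" "North 1 \<noteq> c" using TL_ends[OF TL l] by auto
  have D_iff: "compatible (D, B') g \<longleftrightarrow> line_compatible ({North 1, c} \<in> B') g {North 1, c} \<and>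
      (\<forall>l\<in>D - {{North 1, c}}. line_compatible (l \<in> B') g l)" for B' g
    unfolding compatible_def using l by auto
  have same: "letter n u w r x = letter n v w r x"
    if "cap_mask n (False, 1) (True, 1) v u" "x \<in> nodes n" "x \<noteq> North 1" for u v w r x
    using that by (intro letter_cong) (auto simp: cap_mask_def)
  have other: "(\<forall>l\<in>D - {{North 1, c}}. line_compatible (l \<in> B - {{North 1, c}}) (letter n u w) l) \<longleftrightarrow>
      (\<forall>l\<in>D - {{North 1, c}}. line_compatible (l \<in> B) (letter n v w) l)"
    if "cap_mask n (False, 1) (True, 1) v u" for u v w
  proof (rule ball_cong[OF refl])
    fix l' assume l': "l' \<in> D - {{North 1, c}}"
    then have "x \<noteq> North 1 \<and> x \<in> nodes n" if "x \<in> l'" for x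
      using that TL_same_line[OF TL _ l, of l' "North 1"] TL unfolding TL_diagrams_def partition_on_def by blast
    then show "line_compatible (l' \<in> B - {{North 1, c}}) (letter n u w) l' \<longleftrightarrow>
        line_compatible (l' \<in> B) (letter n v w) l'"
      using line_compatible_cong[of l' "letter n u w" "letter n v w"] same[OF that] l' by simp
  qed
  have determined: "half n u r 1 = (\<not> letter n v w r c)"
    if "cap_mask n (False, 1) (True, 1) v u" "diagram_mask n (D, B - {{North 1, c}}) u w" for u v w r
    using that same[OF that(1) cn(1)] cn(2) line_compatible_pair[OF cn(2)]
    unfolding diagram_mask_def D_iff by auto
  show "u = u'" if u: "cap_mask n (False, 1) (True, 1) v u" "diagram_mask n (D, B - {{North 1, c}}) u w"
    and u': "cap_mask n (False, 1) (True, 1) v u'" "diagram_mask n (D, B - {{North 1, c}}) u' w" for v w u u'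
  proof (rule words_eqI)
    show "u \<in> words (2 * n)" "u' \<in> words (2 * n)" using u u' unfolding cap_mask_def by auto
    fix r j assume j: "1 \<le> j" "j \<le> n"
    show "half n u r j = half n u' r j"
    proof (cases "j = 1")
      case True then show ?thesis using determined[OF u] determined[OF u'] by simp
    next
      case False then show ?thesis using u(1) u'(1) j unfolding cap_mask_def by auto
    qed
  qed
  fix v w
  show "(\<exists>u. cap_mask n (False, 1) (True, 1) v u \<and> diagram_mask n (D, B - {{North 1, c}}) u w) \<longleftrightarrow>
      diagram_mask n (D, B) v w"
  proof
    assume "\<exists>u. cap_mask n (False, 1) (True, 1) v u \<and> diagram_mask n (D, B - {{North 1, c}}) u w"
    then obtain u where u: "cap_mask n (False, 1) (True, 1) v u" "diagram_mask n (D, B - {{North 1, c}}) u w"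
      by blast
    have "letter n v w True c \<noteq> letter n v w False c"
      using determined[OF u, of True] determined[OF u, of False] u(1) unfolding cap_mask_def by auto
    then have "line_compatible True (letter n v w) {North 1, c}"
      using u(1) unfolding line_compatible_pair[OF cn(2)] cap_mask_def by auto
    then show "diagram_mask n (D, B) v w"
      using u other[OF u(1)] c unfolding diagram_mask_def D_iff cap_mask_def by auto
  next
    assume vw: "diagram_mask n (D, B) v w"
    obtain u where u: "u \<in> words (2 * n)"
      "\<And>r j. 1 \<le> j \<Longrightarrow> j \<le> n \<Longrightarrow> half n u r j = (if j = 1 then \<not> letter n v w r c else half n v r j)"
      using word_exists[of n "\<lambda>r j. if j = 1 then \<not> letter n v w r c else half n v r j"] by blast
    have "line_compatible True (letter n v w) {North 1, c}"
      using vw c unfolding diagram_mask_def D_iff by simp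
    then have ne: "half n v True 1 \<noteq> half n v False 1" "letter n v w True c \<noteq> letter n v w False c"
      unfolding line_compatible_pair[OF cn(2)] by auto
    have vu: "cap_mask n (False, 1) (True, 1) v u"
      using ne u n vw unfolding cap_mask_def diagram_mask_def by auto
    then have "line_compatible False (letter n u w) {North 1, c}"
      using same[OF vu cn(1)] cn(2) u(2)[of 1] n unfolding line_compatible_pair[OF cn(2)] by auto
    then have "diagram_mask n (D, B - {{North 1, c}}) u w"
      using vw u(1) other[OF vu] unfolding diagram_mask_def D_iff by simp
    then show "\<exists>u. cap_mask n (False, 1) (True, 1) v u \<and> diagram_mask n (D, B - {{North 1, c}}) u w"
      using vu by blast
  qed
qed

definition U_mask :: "nat \<Rightarrow> nat \<Rightarrow> nat list \<Rightarrow> nat list \<Rightarrow> bool" where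
  "U_mask n i v w \<longleftrightarrow> v \<in> words (2 * n) \<and> w \<in> words (2 * n) \<and>
    (\<forall>r. half n v r i \<noteq> half n v r (i + 1) \<and> half n w r i \<noteq> half n w r (i + 1)) \<and>
    (\<forall>r j. 1 \<le> j \<longrightarrow> j \<le> n \<longrightarrow> j \<noteq> i \<longrightarrow> j \<noteq> i + 1 \<longrightarrow> half n v r j = half n w r j)"

text \<open>The two factors act on opposite halves, so the only possible intermediate word has the
  right half of \<open>v\<close> and the left half of \<open>w\<close>.\<close>

lemma has_mask_U:
  assumes i: "1 \<le> i" "i < n"
    and X: "has_mask (2 * n) X (cap_mask n (False, i + 1) (False, i))"
    and Y: "has_mask (2 * n) Y (cap_mask n (True, i) (True, i + 1))"
  shows "has_mask (2 * n) (X \<otimes>\<^bsub>matrix_algebra (2 * n)\<^esub> Y) (U_mask n i)"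
proof (rule has_mask_mult[OF X Y])
  show "u = u'" if "cap_mask n (False, i + 1) (False, i) v u" "cap_mask n (True, i) (True, i + 1) u w"
    "cap_mask n (False, i + 1) (False, i) v u'" "cap_mask n (True, i) (True, i + 1) u' w" for v w u u'
  proof (rule words_eqI)
    show "u \<in> words (2 * n)" "u' \<in> words (2 * n)" using that unfolding cap_mask_def by auto
    show "half n u r j = half n u' r j" if "1 \<le> j" "j \<le> n" for r j
      using \<open>cap_mask n (False, i + 1) (False, i) v u\<close> \<open>cap_mask n (True, i) (True, i + 1) u w\<close>
        \<open>cap_mask n (False, i + 1) (False, i) v u'\<close> \<open>cap_mask n (True, i) (True, i + 1) u' w\<close> that
      unfolding cap_mask_def by (cases r) auto
  qed
  fix v w
  show "(\<exists>u. cap_mask n (False, i + 1) (False, i) v u \<and> cap_mask n (True, i) (True, i + 1) u w) \<longleftrightarrow> U_mask n i v w"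
  proof
    assume "\<exists>u. cap_mask n (False, i + 1) (False, i) v u \<and> cap_mask n (True, i) (True, i + 1) u w"
    then obtain u where u: "cap_mask n (False, i + 1) (False, i) v u" "cap_mask n (True, i) (True, i + 1) u w"
      by blast
    have "half n v r i \<noteq> half n v r (i + 1)" "half n w r i \<noteq> half n w r (i + 1)" for r
      using u i unfolding cap_mask_def by (cases r; auto)+
    moreover have "half n v r j = half n w r j" if "1 \<le> j" "j \<le> n" "j \<noteq> i" "j \<noteq> i + 1" for r j
      using u that unfolding cap_mask_def by auto
    ultimately show "U_mask n i v w" using u unfolding U_mask_def cap_mask_def by auto
  next
    assume vw: "U_mask n i v w"
    obtain u where u: "u \<in> words (2 * n)"
      "\<And>r j. 1 \<le> j \<Longrightarrow> j \<le> n \<Longrightarrow> half n u r j = (if r then half n v r j else half n w r j)"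
      using word_exists[of n "\<lambda>r j. if r then half n v r j else half n w r j"] by blast
    have "cap_mask n (False, i + 1) (False, i) v u" "cap_mask n (True, i) (True, i + 1) u w"
      using vw u i unfolding cap_mask_def U_mask_def by auto
    then show "\<exists>u. cap_mask n (False, i + 1) (False, i) v u \<and> cap_mask n (True, i) (True, i + 1) u w" by blast
  qed
qed

context cap_removal
begin

lemma compatible_iff:
  "compatible (D, B) g \<longleftrightarrow> line_compatible False g {North i, North (i + 1)} \<and> line_compatible blob g {a, b} \<and>
    (\<forall>l\<in>D\<^sub>0. line_compatible (l \<in> B\<^sub>0) g l)"
  "compatible (D', B') g \<longleftrightarrow> line_compatible blob g {North i, a} \<and> line_compatible False g {North (i + 1), b} \<and>
    (\<forall>l\<in>D\<^sub>0. line_compatible (l \<in> B\<^sub>0) g l)"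
proof -
  have "l \<in> B \<longleftrightarrow> l \<in> B\<^sub>0" "l \<in> B' \<longleftrightarrow> l \<in> B\<^sub>0" if "l \<in> D\<^sub>0" for l
    using D\<^sub>0[OF that] unfolding B_def B'_def by auto
  then show "compatible (D, B) g \<longleftrightarrow> line_compatible False g {North i, North (i + 1)} \<and> line_compatible blob g {a, b} \<and>
    (\<forall>l\<in>D\<^sub>0. line_compatible (l \<in> B\<^sub>0) g l)"
  "compatible (D', B') g \<longleftrightarrow> line_compatible blob g {North i, a} \<and> line_compatible False g {North (i + 1), b} \<and>
    (\<forall>l\<in>D\<^sub>0. line_compatible (l \<in> B\<^sub>0) g l)"
    using notin_blobs unfolding compatible_def by (simp_all add: D_def D'_def)
qed

text \<open>The intermediate word is read off from \<open>b\<close> and not from \<open>a\<close>: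
  the line \<open>{North (i + 1), b}\<close> is always plain and fixes the letters of column
  \<open>i + 1\<close>, and the southern arc of the generator then gives column \<open>i\<close> the
  letters of \<open>b\<close>. So the condition on \<open>{North i, a}\<close>, blobbed or plain,
  becomes the same condition on \<open>{a, b}\<close>.\<close>

lemma has_mask_U_step:
  assumes U: "has_mask (2 * n) U (U_mask n i)" and M: "has_mask (2 * n) M (diagram_mask n (D', B'))"
  shows "has_mask (2 * n) (U \<otimes>\<^bsub>matrix_algebra (2 * n)\<^esub> M) (diagram_mask n (D, B))"
proof (rule has_mask_mult[OF U M])
  have same: "letter n u w r x = letter n v w r x"
    if "U_mask n i v u" "x \<in> nodes n" "x \<noteq> North i" "x \<noteq> North (i + 1)" for u v w r x
    using that by (intro letter_cong) (auto simp: U_mask_def)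
  have other: "(\<forall>l\<in>D\<^sub>0. line_compatible (l \<in> B\<^sub>0) (letter n u w) l) \<longleftrightarrow>
      (\<forall>l\<in>D\<^sub>0. line_compatible (l \<in> B\<^sub>0) (letter n v w) l)"
    if U: "U_mask n i v u" for u v w
  proof (rule ball_cong[OF refl])
    fix l assume l: "l \<in> D\<^sub>0"
    have "\<Union>D = nodes n" using TL_Union[OF conjunct1[OF D[unfolded blob_diagram_iff]]] .
    moreover have "l \<in> D" using l unfolding D_def by simp
    ultimately have "x \<in> nodes n" if "x \<in> l" for x using that by blast
    then show "line_compatible (l \<in> B\<^sub>0) (letter n u w) l \<longleftrightarrow> line_compatible (l \<in> B\<^sub>0) (letter n v w) l"
      using D\<^sub>0[OF l] by (intro line_compatible_cong same[OF U]) auto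
  qed
  have determined: "half n u r (i + 1) = (\<not> letter n v w r b)" "half n u r i = letter n v w r b"
    if "U_mask n i v u" "diagram_mask n (D', B') u w" for u v w r
  proof -
    have "line_compatible False (letter n u w) {North (i + 1), b}"
      using that(2) unfolding diagram_mask_def compatible_iff by blast
    then show "half n u r (i + 1) = (\<not> letter n v w r b)"
      using same[OF that(1) ab(2)] ab unfolding line_compatible_pair[OF ab(7)] by auto
    then show "half n u r i = letter n v w r b" using that(1) unfolding U_mask_def by auto
  qed
  show "u = u'" if u: "U_mask n i v u" "diagram_mask n (D', B') u w"
    and u': "U_mask n i v u'" "diagram_mask n (D', B') u' w" for v w u u'
  proof (rule words_eqI)
    show "u \<in> words (2 * n)" "u' \<in> words (2 * n)" using u u' unfolding U_mask_def by auto
    fix r j assume "1 \<le> j" "j \<le> n"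
    then show "half n u r j = half n u' r j"
      using determined[OF u] determined[OF u'] u(1) u'(1) unfolding U_mask_def by metis
  qed
  fix v w
  show "(\<exists>u. U_mask n i v u \<and> diagram_mask n (D', B') u w) \<longleftrightarrow> diagram_mask n (D, B) v w"
  proof
    assume "\<exists>u. U_mask n i v u \<and> diagram_mask n (D', B') u w"
    then obtain u where u: "U_mask n i v u" "diagram_mask n (D', B') u w" by blast
    have "line_compatible blob (letter n u w) {North i, a}"
      using u(2) unfolding diagram_mask_def compatible_iff by blast
    then have "line_compatible blob (letter n v w) {a, b}"
      using same[OF u(1) ab(1)] determined(2)[OF u] ab
      unfolding line_compatible_pair[OF ab(3)] line_compatible_pair[OF ab(4)] by (auto split: if_splits)
    moreover have "line_compatible False (letter n v w) {North i, North (i + 1)}"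
      using u(1) unfolding U_mask_def by (simp add: line_compatible_pair)
    ultimately show "diagram_mask n (D, B) v w"
      using u other[OF u(1)] unfolding diagram_mask_def compatible_iff U_mask_def by blast
  next
    assume vw: "diagram_mask n (D, B) v w"
    obtain u where u: "u \<in> words (2 * n)"
      "\<And>r j. 1 \<le> j \<Longrightarrow> j \<le> n \<Longrightarrow> half n u r j =
        (if j = i then letter n v w r b else if j = i + 1 then \<not> letter n v w r b else half n v r j)"
      using word_exists[of n "\<lambda>r j. if j = i then letter n v w r b else if j = i + 1 then \<not> letter n v w r b else half n v r j"] by blast
    have ne: "line_compatible False (letter n v w) {North i, North (i + 1)}"
        "line_compatible blob (letter n v w) {a, b}"
      using vw unfolding diagram_mask_def compatible_iff by blast+
    then have vu: "U_mask n i v u"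
      using u i vw unfolding U_mask_def diagram_mask_def by (simp add: line_compatible_pair)
    have "line_compatible blob (letter n u w) {North i, a}" "line_compatible False (letter n u w) {North (i + 1), b}"
      using ne(2) same[OF vu ab(1)] same[OF vu ab(2)] u(2) i ab
      unfolding line_compatible_pair[OF ab(3)] line_compatible_pair[OF ab(4)] line_compatible_pair[OF ab(7)]
      by (auto split: if_splits)
    then have "diagram_mask n (D', B') u w"
      using vw u(1) other[OF vu] unfolding diagram_mask_def compatible_iff by blast
    then show "\<exists>u. U_mask n i v u \<and> diagram_mask n (D', B') u w" using vu by blast
  qed
qed

end

section \<open>Triangularity\<close>

definition opens :: "nat \<Rightarrow> blob_diagram \<Rightarrow> node \<Rightarrow> bool" where
  "opens n d x \<longleftrightarrow> x \<in> \<Union>(snd d) \<or> (\<exists>y. {x, y} \<in> fst d \<and> pos n x < pos n y)"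

text \<open>The weights fall from \<open>2 * n\<close> at the first position to 1 at the last. They
  are positive, so an extra mark raises the rank, and strictly decreasing, so moving a mark forward
  raises it too.\<close>

definition opens_rank :: "nat \<Rightarrow> (node \<Rightarrow> bool) \<Rightarrow> nat" where
  "opens_rank n g = (\<Sum>x\<in>nodes n. if g x then 2 * n + 1 - pos n x else 0)"

context
  fixes n :: nat and D B :: "node set set"
  assumes DB: "(D, B) \<in> blob_diagrams n"
begin

lemma blob_TL: "D \<in> TL_diagrams n" and blob_subset: "B \<subseteq> D"
  using DB unfolding blob_diagram_iff by auto

lemma blob_exposed:
  "l \<in> B \<Longrightarrow> a \<in> l \<Longrightarrow> {c, d} \<in> D \<Longrightarrow> pos n c < pos n a \<Longrightarrow> pos n a < pos n d \<Longrightarrow> False"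
  using DB unfolding blob_diagram_iff by blast

lemma opens_blob: "l \<in> B \<Longrightarrow> x \<in> l \<Longrightarrow> opens n (D, B) x"
  by (auto simp: opens_def)

lemma opens_plain:
  assumes "{x, y} \<in> D" "{x, y} \<notin> B"
  shows "opens n (D, B) x \<longleftrightarrow> pos n x < pos n y"
proof -
  have "x \<notin> \<Union>B"
  proof
    assume "x \<in> \<Union>B"
    then obtain l where "l \<in> B" "x \<in> l" by blast
    then have "l = {x, y}" using TL_same_line[OF blob_TL _ assms(1), of l x] blob_subset by blast
    then show False using \<open>l \<in> B\<close> assms(2) by simp
  qed
  moreover have "z = y" if "{x, z} \<in> D" for z using TL_unique[OF blob_TL that assms(1)] .
  then have "(\<exists>z. {x, z} \<in> D \<and> pos n x < pos n z) \<longleftrightarrow> pos n x < pos n y" using assms(1) by blast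
  ultimately show ?thesis unfolding opens_def by simp
qed

lemma not_opens:
  assumes "x \<in> nodes n" "\<not> opens n (D, B) x"
  obtains y where "{y, x} \<in> D" "{y, x} \<notin> B" "pos n y < pos n x"
proof -
  obtain y where y: "{x, y} \<in> D" using TL_partner[OF blob_TL assms(1)] by blast
  have "{x, y} \<notin> B" using opens_blob[of "{x, y}" x] assms(2) by auto
  moreover have "pos n y < pos n x"
    using opens_plain[OF y calculation] assms(2) TL_ends[OF blob_TL y] pos_eq_iff[of x n y] by auto
  ultimately show ?thesis using that y by (auto simp: insert_commute)
qed

text \<open>Among the markings that mark exactly one end of each plain line, the diagram's own is
  the unique one of maximal rank: it marks the earlier end, and both ends of every blob
  line.\<close>

lemma opens_rank_le:
  assumes g: "\<And>x y. {x, y} \<in> D \<Longrightarrow> {x, y} \<notin> B \<Longrightarrow> g x \<noteq> g y"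
  shows "opens_rank n g \<le> opens_rank n (opens n (D, B))"
    and "opens_rank n g = opens_rank n (opens n (D, B)) \<Longrightarrow> x \<in> nodes n \<Longrightarrow> g x = opens n (D, B) x"
proof -
  let ?o = "opens n (D, B)"
  define f where "f g l = (\<Sum>x\<in>l. if g x then 2 * n + 1 - pos n x else 0)" for g l
  have sum: "opens_rank n g = sum (f g) D" for g
  proof -
    have "opens_rank n g = (\<Sum>x\<in>\<Union>D. if g x then 2 * n + 1 - pos n x else 0)"
      unfolding opens_rank_def TL_Union[OF blob_TL] ..
    also have "\<dots> = sum (f g) D"
      unfolding f_def comp_def[symmetric]
    proof (subst sum.Union_disjoint)
      show "\<forall>l\<in>D. finite l" using TL_lineE[OF blob_TL] by (metis finite.emptyI finite.insertI)
      show "\<forall>A\<in>D. \<forall>B\<in>D. A \<noteq> B \<longrightarrow> A \<inter> B = {}" using TL_same_line[OF blob_TL] by blast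
    qed (simp add: comp_def f_def)
    finally show ?thesis .
  qed
  \<comment> \<open>Lines are disjoint, so the comparison can be made line by line, with a strict
    loss wherever the markings differ.\<close>
  have line: "(\<forall>x\<in>l. g x = ?o x) \<or> f g l < f ?o l" if l: "l \<in> D" for l
  proof -
    obtain x y where xy: "l = {x, y}" "pos n x < pos n y" using TL_lineE[OF blob_TL l] by metis
    have nodes: "x \<in> nodes n" "y \<in> nodes n" "x \<noteq> y" using TL_ends[OF blob_TL] l xy by auto
    then have range: "pos n x < 2 * n + 1" "pos n y < 2 * n + 1" using pos_range[of _ n] by force+
    have f: "f h l = (if h x then 2 * n + 1 - pos n x else 0) + (if h y then 2 * n + 1 - pos n y else 0)" for h
      unfolding f_def xy using nodes by simp
    show ?thesis
    proof (cases "l \<in> B")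
      case True
      then have "?o x" "?o y" using opens_blob[OF True] xy by auto
      then show ?thesis unfolding f using xy range by auto
    next
      case False
      then have "?o x" "\<not> ?o y" "g x \<noteq> g y"
        using opens_plain[of x y] opens_plain[of y x] g[of x y] l xy by (auto simp: insert_commute)
      then show ?thesis unfolding f using xy range by auto
    qed
  qed
  have le: "f g l \<le> f ?o l" if "l \<in> D" for l
  proof (cases "\<forall>x\<in>l. g x = ?o x")
    case True
    then show ?thesis unfolding f_def by (simp cong: sum.cong)
  next
    case False
    then have "f g l < f ?o l" using line[OF that] by blast
    then show ?thesis by simp
  qed
  show "opens_rank n g \<le> opens_rank n ?o" unfolding sum using le by (rule sum_mono)
  show "g x = ?o x" if eq: "opens_rank n g = opens_rank n ?o" and x: "x \<in> nodes n"
  proof (rule ccontr)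
    assume ne: "g x \<noteq> ?o x"
    obtain l where "l \<in> D" "x \<in> l" using TL_cover[OF blob_TL x] by blast
    then have "\<exists>l\<in>D. f g l < f ?o l" using ne line by blast
    then have "sum (f g) D < sum (f ?o) D" using le finite_TL[OF blob_TL] by (intro sum_strict_mono_ex1) auto
    then show False using eq unfolding sum by simp
  qed
qed

end

text \<open>Bracket matching, by induction on the distance of the ends. Lines below
  \<open>{x, y}\<close> are not exposed, hence plain, and shorter, hence already shared with
  \<open>D'\<close>. So the partner of \<open>y\<close> in \<open>D'\<close> cannot lie strictly
  between \<open>x\<close> and \<open>y\<close>.\<close>

lemma plain_lines_determined:
  assumes DB: "(D, B) \<in> blob_diagrams n" and DB': "(D', B') \<in> blob_diagrams n"
    and same: "\<And>x. x \<in> nodes n \<Longrightarrow> opens n (D, B) x = opens n (D', B') x"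
    and xy: "{x, y} \<in> D" "{x, y} \<notin> B" "pos n x < pos n y"
  shows "{x, y} \<in> D' - B'"
  using xy
proof (induction "pos n y - pos n x" arbitrary: x y rule: less_induct)
  case less
  note xy = less.prems
  note TL = blob_TL[OF DB] and TL' = blob_TL[OF DB']
  have nodes: "x \<in> nodes n" "y \<in> nodes n" using TL_ends[OF TL xy(1)] by auto
  have inside: "\<exists>t. {z, t} \<in> D' \<and> pos n x < pos n t \<and> pos n t < pos n y"
    if z: "z \<in> nodes n" "pos n x < pos n z" "pos n z < pos n y" for z
  proof -
    obtain t where t: "{z, t} \<in> D" using TL_partner[OF TL z(1)] by blast
    have t_in: "pos n x < pos n t \<and> pos n t < pos n y" using TL_nested[OF TL xy(1) t z(2,3)] .
    have tB: "{z, t} \<notin> B" using blob_exposed[OF DB _ _ xy(1) z(2,3), of "{z, t}"] by auto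
    have "pos n z \<noteq> pos n t" using TL_ends[OF TL t] pos_eq_iff by metis
    then have "{z, t} \<in> D' - B'"
    proof (cases "pos n z < pos n t")
      case True
      then show ?thesis using less.hyps[of t z] t tB t_in z by auto
    next
      case False
      then show ?thesis using less.hyps[of z t] t tB t_in z \<open>pos n z \<noteq> pos n t\<close> by (auto simp: insert_commute)
    qed
    then show ?thesis using t_in by blast
  qed
  have "\<not> opens n (D, B) y"
    using opens_plain[OF DB, of y x] xy by (auto simp: insert_commute)
  then obtain x' where x': "{x', y} \<in> D'" "{x', y} \<notin> B'" "pos n x' < pos n y"
    using not_opens[OF DB' nodes(2)] same[OF nodes(2)] by blast
  have nx': "x' \<in> nodes n" using TL_ends[OF TL' x'(1)] by blast
  have "\<not> pos n x < pos n x'"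
  proof
    assume "pos n x < pos n x'"
    then obtain t where "{x', t} \<in> D'" "pos n t < pos n y" using inside[OF nx' _ x'(3)] by blast
    then show False using TL_unique[OF TL' x'(1), of t] by simp
  qed
  \<comment> \<open>Otherwise \<open>x\<close> lies under \<open>{x', y}\<close> in
    \<open>D'\<close> and carries no blob there. Being marked, it has a partner between
    \<open>x\<close> and \<open>y\<close>; but that node already has its partner strictly between
    them.\<close>
  moreover have "\<not> pos n x' < pos n x"
  proof
    assume less: "pos n x' < pos n x"
    obtain r where r: "{x, r} \<in> D'" using TL_partner[OF TL' nodes(1)] by blast
    have "{x, r} \<notin> B'" using blob_exposed[OF DB' _ _ x'(1) less xy(3), of "{x, r}"] by auto
    moreover have "opens n (D', B') x" using same[OF nodes(1)] opens_plain[OF DB xy(1,2)] xy(3) by simp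
    ultimately have "pos n x < pos n r" using opens_plain[OF DB' r] by simp
    moreover have "pos n r < pos n y" using TL_nested[OF TL' x'(1) r less xy(3)] by simp
    moreover have "r \<in> nodes n" using TL_ends[OF TL' r] by blast
    ultimately obtain t where t: "{r, t} \<in> D'" "pos n x < pos n t" using inside by blast
    then have "t = x" using TL_unique[OF TL' t(1), of x] r by (simp add: insert_commute)
    then show False using t by simp
  qed
  ultimately have "x' = x" using pos_eq_iff[OF nx' nodes(1)] by simp
  then show ?case using x' by simp
qed

text \<open>Equal plain lines leave the same nodes to the blob lines. These are exposed, hence never
  nested, and so join consecutive remaining nodes; the induction runs over the position of the first
  end.\<close>

lemma blob_lines_determined:
  assumes DB: "(D, B) \<in> blob_diagrams n" and DB': "(D', B') \<in> blob_diagrams n"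
    and plain: "D - B = D' - B'" and xy: "{x, y} \<in> B" "pos n x < pos n y"
  shows "{x, y} \<in> B'"
  using xy
proof (induction "pos n x" arbitrary: x y rule: less_induct)
  case less
  note xy = less.prems
  note TL = blob_TL[OF DB] and TL' = blob_TL[OF DB'] and sub = blob_subset[OF DB] and sub' = blob_subset[OF DB']
  have D: "{x, y} \<in> D" using xy sub by blast
  have nodes: "x \<in> nodes n" "y \<in> nodes n" using TL_ends[OF TL D] by auto
  have blobbed: "l' \<in> B'" if "l \<in> B" "z \<in> l" "l' \<in> D'" "z \<in> l'" for l l' z
  proof (rule ccontr)
    assume "l' \<notin> B'"
    then have "l' \<in> D - B" using that plain by blast
    then show False using TL_same_line[OF TL, of l' l z] that sub by blast
  qed
  have blobbed': "l \<in> B" if "l' \<in> B'" "z \<in> l'" "l \<in> D" "z \<in> l" for l l' z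
  proof (rule ccontr)
    assume "l \<notin> B"
    then have "l \<in> D' - B'" using that plain by blast
    then show False using TL_same_line[OF TL', of l l' z] that sub' by blast
  qed
  obtain r where r: "{x, r} \<in> D'" using TL_partner[OF TL' nodes(1)] by blast
  have rB: "{x, r} \<in> B'" using blobbed[OF xy(1) _ r] by blast
  have nr: "r \<in> nodes n" "r \<noteq> x" using TL_ends[OF TL' r] by auto
  obtain s where s: "{r, s} \<in> D" using TL_partner[OF TL nr(1)] by blast
  have sB: "{r, s} \<in> B" using blobbed'[OF rB _ s] by blast
  obtain t where t: "{y, t} \<in> D'" using TL_partner[OF TL' nodes(2)] by blast
  have tB: "{y, t} \<in> B'" using blobbed[OF xy(1) _ t] by blast
  have "\<not> pos n r < pos n x"
  proof
    assume rx: "pos n r < pos n x"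
    have "pos n s \<noteq> pos n r" using TL_ends[OF TL s] pos_eq_iff[of s n r] by auto
    have "{r, s} \<in> B'"
    proof (cases "pos n r < pos n s")
      case True then show ?thesis using less.hyps[OF rx sB] by simp
    next
      case False
      then show ?thesis using less.hyps[of s r] rx sB \<open>pos n s \<noteq> pos n r\<close> by (simp add: insert_commute)
    qed
    then have "s = x" using TL_unique[OF TL', of r s x] r sub' by (auto simp: insert_commute)
    then have "r = y" using TL_unique[OF TL D, of r] s by (simp add: insert_commute)
    then show False using rx xy(2) by simp
  qed
  then have xr: "pos n x < pos n r" using pos_eq_iff[OF nr(1) nodes(1)] nr(2) by simp
  have "\<not> pos n r < pos n y" using blob_exposed[OF DB sB _ D xr] by auto
  moreover have "\<not> pos n y < pos n r" using blob_exposed[OF DB' tB _ r xy(2)] by auto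
  ultimately have "r = y" using pos_eq_iff[OF nr(1) nodes(2)] by simp
  then show ?case using rB by simp
qed

lemma opens_inj:
  assumes d: "d \<in> blob_diagrams n" "d' \<in> blob_diagrams n"
    and same: "\<And>x. x \<in> nodes n \<Longrightarrow> opens n d x = opens n d' x"
  shows "d = d'"
proof -
  have plain: "D - B \<subseteq> D' - B'" if DB: "(D, B) \<in> blob_diagrams n" "(D', B') \<in> blob_diagrams n"
    "\<And>x. x \<in> nodes n \<Longrightarrow> opens n (D, B) x = opens n (D', B') x" for D B D' B'
  proof
    fix l assume l: "l \<in> D - B"
    then have "l \<in> D" by simp
    then obtain x y where xy: "l = {x, y}" "pos n x < pos n y" by (rule TL_lineE[OF blob_TL[OF DB(1)]])
    then show "l \<in> D' - B'" using plain_lines_determined[OF DB, of x y] l by blast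
  qed
  have blob: "B \<subseteq> B'" if DB: "(D, B) \<in> blob_diagrams n" "(D', B') \<in> blob_diagrams n" "D - B = D' - B'"
    for D B D' B'
  proof
    fix l assume l: "l \<in> B"
    then have "l \<in> D" using blob_subset[OF DB(1)] by blast
    then obtain x y where xy: "l = {x, y}" "pos n x < pos n y" by (rule TL_lineE[OF blob_TL[OF DB(1)]])
    then show "l \<in> B'" using blob_lines_determined[OF DB, of x y] l by blast
  qed
  obtain D B D' B' where dd: "d = (D, B)" "d' = (D', B')" by fastforce
  note DB = d[unfolded dd]
  have "D - B = D' - B'" using plain[OF DB] plain[OF DB(2,1)] same unfolding dd by blast
  moreover from this have "B = B'" using blob[OF DB] blob[OF DB(2,1)] by blast
  moreover have "B \<subseteq> D" "B' \<subseteq> D'" using blob_subset DB by blast+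
  ultimately show ?thesis unfolding dd by auto
qed

section \<open>Representations of the blob algebra\<close>

lemma basis_vec_carrier: "d \<in> blob_diagrams n \<Longrightarrow> basis_vec d \<in> carrier (blob_algebra n q \<gamma> \<delta>)"
  by (auto simp: blob_algebra_def basis_vec_def)

lemma basis_vec_mult:
  fixes q \<gamma> \<delta> :: "'k::comm_ring_1"
  assumes "d1 \<in> blob_diagrams n" "d2 \<in> blob_diagrams n" "stack_factor n q \<gamma> \<delta> d1 d2 = 1"
  shows "basis_vec d1 \<otimes>\<^bsub>blob_algebra n q \<gamma> \<delta>\<^esub> basis_vec d2 = (basis_vec (stack n d1 d2) :: _ \<Rightarrow> 'k)"
proof
  fix d
  have "(basis_vec d1 \<otimes>\<^bsub>blob_algebra n q \<gamma> \<delta>\<^esub> basis_vec d2) d =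
      (\<Sum>d1'\<in>blob_diagrams n. \<Sum>d2'\<in>blob_diagrams n. if d2' = d2 then if d1' = d1 then
        if stack n d1 d2 = d then stack_factor n q \<gamma> \<delta> d1 d2 else 0 else 0 else (0 :: 'k))"
    unfolding blob_algebra_def by (auto simp: basis_vec_def intro!: sum.cong)
  also have "\<dots> = basis_vec (stack n d1 d2) d"
    using assms finite_blob_diagrams by (simp add: sum.delta basis_vec_def)
  finally show "(basis_vec d1 \<otimes>\<^bsub>blob_algebra n q \<gamma> \<delta>\<^esub> basis_vec d2) d = (basis_vec (stack n d1 d2) d :: 'k)" .
qed

lemma U_diagram: "1 \<le> i \<Longrightarrow> i < n \<Longrightarrow> (cup_cap n i, {}) \<in> blob_diagrams n"
  using cup_cap_TL by (simp add: blob_diagram_iff)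

lemma e_diagram:
  assumes "1 \<le> n"
  shows "(id_lines n, {{North 1, South 1}}) \<in> blob_diagrams n"
proof -
  have l: "{North 1, South 1} \<in> id_lines n" using assms unfolding id_lines_def by auto
  have "pos n c \<ge> 1" if "{c, d} \<in> id_lines n" for c d
    using TL_ends[OF id_lines_TL that] pos_range by blast
  then have "exposed n (id_lines n) {North 1, South 1}"
    using exposed_iff[OF id_lines_TL l, of "North 1"] by fastforce
  then show ?thesis using id_lines_TL by (simp add: blob_diagrams_def)
qed

lemma representation_sum:
  fixes q \<gamma> \<delta> :: "'k::comm_ring_1"
  assumes \<rho>: "representation n q \<gamma> \<delta> \<rho>" and f: "f \<in> carrier (blob_algebra n q \<gamma> \<delta>)"
  shows "\<rho> f v w = (\<Sum>d\<in>blob_diagrams n. f d * \<rho> (basis_vec d) v w)"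
proof -
  let ?A = "blob_algebra n q \<gamma> \<delta>"
  have smult: "\<rho> (\<lambda>d. c * f d) = (\<lambda>v w. c * \<rho> f v w)" if "f \<in> carrier ?A" for c f
    using \<rho> that unfolding representation_def by (simp add: blob_algebra_def matrix_algebra_def)
  have add: "\<rho> (\<lambda>d. f d + g d) = (\<lambda>v w. \<rho> f v w + \<rho> g v w)" if "f \<in> carrier ?A" "g \<in> carrier ?A" for f g
    using \<rho> that unfolding representation_def ring_hom_def by (simp add: blob_algebra_def matrix_algebra_def)
  have carrier: "h \<in> carrier ?A \<longleftrightarrow> (\<forall>d. d \<notin> blob_diagrams n \<longrightarrow> h d = 0)" for h
    by (simp add: blob_algebra_def)
  have partial: "\<rho> (\<lambda>d. if d \<in> S then f d else 0) v w = (\<Sum>d\<in>S. f d * \<rho> (basis_vec d) v w)"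
    if "S \<subseteq> blob_diagrams n" for S
  proof -
    have "finite S" using that finite_blob_diagrams finite_subset by blast
    then show ?thesis using that
    proof (induction S rule: finite_induct)
      case empty
      have "\<rho> (\<lambda>d. 0) = (\<lambda>v w. 0)" using smult[of "\<lambda>d. 0" 0] by (simp add: carrier)
      then show ?case by simp
    next
      case (insert d S)
      have "(\<lambda>d'. if d' \<in> insert d S then f d' else 0) =
          (\<lambda>d'. f d * basis_vec d d' + (if d' \<in> S then f d' else 0))"
        using insert(2) by (auto simp: basis_vec_def)
      moreover have "(\<lambda>d'. f d * basis_vec d d') \<in> carrier ?A" "basis_vec d \<in> carrier ?A"
        "(\<lambda>d'. if d' \<in> S then f d' else 0) \<in> carrier ?A"
        using insert(4) by (auto simp: carrier basis_vec_def)
      ultimately show ?case using insert by (simp add: add smult)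
    qed
  qed
  have "(\<lambda>d. if d \<in> blob_diagrams n then f d else 0) = f" using f by (auto simp: carrier)
  then show ?thesis using partial[OF order_refl] by simp
qed

text \<open>Node \<open>n + j\<close> has list index \<open>n + j - 1\<close>, so index
  \<open>n - 1\<close> is column 1 of the left half and index \<open>n\<close> is column 1 of the
  right half. Left columns are counted towards the west, whence the order \<open>i + 1\<close>,
  \<open>i\<close> in the second claim.\<close>

lemma shifted_U_mask:
  assumes h: "h dvd (1 :: 'k::comm_ring_1)" and n: "1 \<le> n"
  shows "R_matrix (2 * n) h (shifted_U n 0) v w \<noteq> 0 \<longleftrightarrow> cap_mask n (False, 1) (True, 1) v w"
    and "1 \<le> i \<Longrightarrow> i < n \<Longrightarrow>
      R_matrix (2 * n) h (shifted_U n (- int i)) v w \<noteq> 0 \<longleftrightarrow> cap_mask n (False, i + 1) (False, i) v w"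
    and "1 \<le> i \<Longrightarrow> i < n \<Longrightarrow>
      R_matrix (2 * n) h (shifted_U n (int i)) v w \<noteq> 0 \<longleftrightarrow> cap_mask n (True, i) (True, i + 1) v w"
proof -
  show "R_matrix (2 * n) h (shifted_U n 0) v w \<noteq> 0 \<longleftrightarrow> cap_mask n (False, 1) (True, 1) v w"
    using R_matrix_cap_mask[OF h, of n n "(False, 1)" "(True, 1)"] n
    by (simp add: shifted_U_def half_index_def)
  assume i: "1 \<le> i" "i < n"
  then have "nat (int n - int i) = n - i" "nat (int n + int i) = n + i" by linarith+
  then show "R_matrix (2 * n) h (shifted_U n (- int i)) v w \<noteq> 0 \<longleftrightarrow> cap_mask n (False, i + 1) (False, i) v w"
    "R_matrix (2 * n) h (shifted_U n (int i)) v w \<noteq> 0 \<longleftrightarrow> cap_mask n (True, i) (True, i + 1) v w"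
    using R_matrix_cap_mask[OF h, of "n - i" n "(False, i + 1)" "(False, i)"]
      R_matrix_cap_mask[OF h, of "n + i" n "(True, i)" "(True, i + 1)"] i
    by (simp_all add: shifted_U_def half_index_def)
qed

text \<open>Induction on the length of the diagram. Each factorisation has stacking factor 1, so
  \<open>\<rho>\<close> of the basis vector is exactly the product of the matrices already
  understood.\<close>

lemma mirror_representation_mask:
  fixes q \<gamma> \<delta> :: "'k::comm_ring_1"
  assumes n: "1 \<le> n" and mirror: "mirror_representation n q \<gamma> \<delta> \<rho> X Y"
    and e: "regular_entries (\<rho> (blob_e n))"
    and XY: "\<And>i. 1 \<le> i \<Longrightarrow> i \<le> n - 1 \<Longrightarrow> regular_entries (X i) \<and> regular_entries (Y i)"
    and d: "d \<in> blob_diagrams n"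
  shows "has_mask (2 * n) (\<rho> (basis_vec d)) (diagram_mask n d)"
proof -
  let ?A = "blob_algebra n q \<gamma> \<delta>" and ?M = "matrix_algebra (2 * n) :: ('k, 'k word_matrix) module"
  have hom: "\<rho> \<in> ring_hom ?A ?M" using mirror unfolding mirror_representation_def representation_def by blast
  obtain hr hs ht where h: "hr dvd 1" "hs dvd 1" "ht dvd 1"
    and eR: "mask_equiv (2 * n) (\<rho> (blob_e n)) (R_matrix (2 * n) hr (shifted_U n 0))"
    and UR: "\<forall>i. 1 \<le> i \<and> i \<le> n - 1 \<longrightarrow> X i \<in> carrier ?M \<and> Y i \<in> carrier ?M \<and>
          mask_equiv (2 * n) (X i) (R_matrix (2 * n) hs (shifted_U n (- int i))) \<and>
          mask_equiv (2 * n) (Y i) (R_matrix (2 * n) ht (shifted_U n (int i))) \<and>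
          \<rho> (blob_U n i) = X i \<otimes>\<^bsub>?M\<^esub> Y i"
    using mirror unfolding mirror_representation_def by blast
  have words: "cap_mask n x y v w \<Longrightarrow> v \<in> words (2 * n) \<and> w \<in> words (2 * n)" for x y v w
    unfolding cap_mask_def by blast
  have E: "has_mask (2 * n) (\<rho> (blob_e n)) (cap_mask n (False, 1) (True, 1))"
  proof (rule has_mask_equiv[OF _ e eR shifted_U_mask(1)[OF h(1) n] words])
    show "\<rho> (blob_e n) \<in> carrier ?M"
      using ring_hom_closed[OF hom basis_vec_carrier[OF e_diagram[OF n]]] unfolding blob_e_def .
  qed
  have U_i: "has_mask (2 * n) (\<rho> (blob_U n i)) (U_mask n i)" if i: "1 \<le> i" "i < n" for i
  proof -
    have i': "1 \<le> i \<and> i \<le> n - 1" using i by simp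
    note UR = UR[rule_format, OF i'] and XY = XY[OF i'[THEN conjunct1] i'[THEN conjunct2]]
    have "has_mask (2 * n) (X i) (cap_mask n (False, i + 1) (False, i))"
      using UR XY by (intro has_mask_equiv[OF _ _ _ shifted_U_mask(2)[OF h(2) n i] words]) auto
    moreover have "has_mask (2 * n) (Y i) (cap_mask n (True, i) (True, i + 1))"
      using UR XY by (intro has_mask_equiv[OF _ _ _ shifted_U_mask(3)[OF h(3) n i] words]) auto
    ultimately show ?thesis using has_mask_U[OF i] UR by simp
  qed
  have product: "\<rho> (basis_vec (stack n d1 d2)) = \<rho> (basis_vec d1) \<otimes>\<^bsub>?M\<^esub> \<rho> (basis_vec d2)"
    if "d1 \<in> blob_diagrams n" "d2 \<in> blob_diagrams n" "stack_factor n q \<gamma> \<delta> d1 d2 = 1" for d1 d2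
    using ring_hom_mult[OF hom basis_vec_carrier[OF that(1)] basis_vec_carrier[OF that(2)]]
    unfolding basis_vec_mult[OF that] .
  show ?thesis using d
  proof (induction "diagram_length d" arbitrary: d rule: less_induct)
    case less
    obtain D B where d: "d = (D, B)" by fastforce
    note DB = less.prems[unfolded d]
    note TL = blob_TL[OF DB]
    consider (e) c where "{North 1, c} \<in> B" | (id) "\<forall>c. {North 1, c} \<notin> B" "D = id_lines n"
      | (U) "\<forall>c. {North 1, c} \<notin> B" "D \<noteq> id_lines n" by blast
    then show ?case
    proof cases
      case e
      let ?d = "(D, B - {{North 1, c}})"
      have "?d \<in> blob_diagrams n" by (rule blob_diagram_remove_e[OF DB n e refl refl])
      moreover have "diagram_length ?d < diagram_length d"
        unfolding d by (rule diagram_length_e[OF DB n e refl refl])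
      ultimately have "has_mask (2 * n) (\<rho> (basis_vec ?d)) (diagram_mask n ?d)" using less.hyps by blast
      then have "has_mask (2 * n) (\<rho> (blob_e n) \<otimes>\<^bsub>?M\<^esub> \<rho> (basis_vec ?d)) (diagram_mask n (D, B))"
        by (rule has_mask_e_step[OF DB n e E])
      moreover have "\<rho> (basis_vec (D, B)) = \<rho> (blob_e n) \<otimes>\<^bsub>?M\<^esub> \<rho> (basis_vec ?d)"
        using product[OF e_diagram[OF n] \<open>?d \<in> blob_diagrams n\<close> stack_factor_e[OF DB n e refl refl]]
        unfolding stack_e[OF DB n e refl refl] blob_e_def .
      ultimately show ?thesis unfolding d by simp
    next
      case id
      \<comment> \<open>In the identity diagram only the leftmost line is exposed, and its blob is
        excluded by the case.\<close>
      have "B = {}"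
      proof (rule ccontr)
        assume "B \<noteq> {}"
        then obtain l where l: "l \<in> B" by blast
        then have "l \<in> D" using blob_subset[OF DB] by blast
        then obtain j where j: "l = {North j, South j}" "1 \<le> j" "j \<le> n" unfolding id id_lines_def by auto
        then have "j \<noteq> 1" using id l by blast
        moreover have "{North 1, South 1} \<in> D" using n unfolding id id_lines_def by auto
        ultimately show False using blob_exposed[OF DB l, of "North j" "North 1" "South 1"] j by auto
      qed
      then have "basis_vec d = \<one>\<^bsub>?A\<^esub>" unfolding d id by (simp add: blob_algebra_def)
      then have "\<rho> (basis_vec d) = \<one>\<^bsub>?M\<^esub>" using ring_hom_one[OF hom] by simp
      then show ?thesis using has_mask_one unfolding d id \<open>B = {}\<close> by simp
    next
      case U
      then obtain i where i: "1 \<le> i" "i < n" "{North i, North (i + 1)} \<in> D"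
        and first: "\<And>a b. {a, b} \<in> D \<Longrightarrow> pos n a \<le> i \<Longrightarrow> pos n a < pos n b"
        using first_cap[OF TL] by metis
      \<comment> \<open>For \<open>i = 1\<close> this is the case assumption. For larger
        \<open>i\<close> no line closes up to \<open>i\<close>, so the line from
        \<open>North 1\<close> ends beyond \<open>North i\<close> and hides the cap from the western
        edge.\<close>
      have "{North i, North (i + 1)} \<notin> B"
      proof
        assume cap: "{North i, North (i + 1)} \<in> B"
        then have "i \<noteq> 1" using U(1) by auto
        obtain c where c: "{North 1, c} \<in> D" using TL_partner[OF TL, of "North 1"] n by auto
        have "\<not> pos n c \<le> i"
        proof
          assume "pos n c \<le> i"
          then have "pos n c < 1" using first[of c "North 1"] c by (simp add: insert_commute)
          then show False using pos_range[of c n] TL_ends[OF TL c] by simp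
        qed
        then show False using blob_exposed[OF DB cap _ c, of "North i"] \<open>i \<noteq> 1\<close> i by simp
      qed
      then obtain a b D\<^sub>0 B\<^sub>0 blob where cr: "cap_removal n i a b D\<^sub>0 B\<^sub>0 blob"
        and D: "D = insert {North i, North (i + 1)} (insert {a, b} D\<^sub>0)"
        and B: "B = (if blob then insert {a, b} B\<^sub>0 else B\<^sub>0)"
        using cap_removal_exists[OF DB i] by metis
      let ?D = "insert {North i, a} (insert {North (i + 1), b} D\<^sub>0)"
      let ?B = "if blob then insert {North i, a} B\<^sub>0 else B\<^sub>0"
      have D': "(?D, ?B) \<in> blob_diagrams n" by (rule cap_removal.D'[OF cr])
      have "diagram_length (?D, ?B) < diagram_length d"
        unfolding d D B by (rule cap_removal.diagram_length_less[OF cr])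
      then have "has_mask (2 * n) (\<rho> (basis_vec (?D, ?B))) (diagram_mask n (?D, ?B))"
        using less.hyps D' by blast
      then have "has_mask (2 * n) (\<rho> (blob_U n i) \<otimes>\<^bsub>?M\<^esub> \<rho> (basis_vec (?D, ?B))) (diagram_mask n (D, B))"
        unfolding D B by (rule cap_removal.has_mask_U_step[OF cr U_i[OF i(1,2)]])
      moreover have "\<rho> (basis_vec (D, B)) = \<rho> (blob_U n i) \<otimes>\<^bsub>?M\<^esub> \<rho> (basis_vec (?D, ?B))"
        using product[OF U_diagram[OF i(1,2)] D' cap_removal.stack_factor_U[OF cr refl refl refl refl refl]]
        unfolding cap_removal.stack_U[OF cr refl refl refl refl refl] blob_U_def D B .
      ultimately show ?thesis unfolding d by simp
    qed
  qed
qed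

section \<open>Test words with opposite letters on mirror images\<close>

lemma antisymmetric_words:
  obtains v w where "v \<in> words (2 * n)" "w \<in> words (2 * n)"
    "\<And>x. x \<in> nodes n \<Longrightarrow> letter n v w True x = g x \<and> letter n v w False x = (\<not> g x)"
proof -
  obtain v where v: "v \<in> words (2 * n)"
    "\<And>r j. 1 \<le> j \<Longrightarrow> j \<le> n \<Longrightarrow> half n v r j = (r = g (North j))"
    using word_exists[of n "\<lambda>r j. r = g (North j)"] by blast
  obtain w where w: "w \<in> words (2 * n)"
    "\<And>r j. 1 \<le> j \<Longrightarrow> j \<le> n \<Longrightarrow> half n w r j = (r \<noteq> g (South j))"
    using word_exists[of n "\<lambda>r j. r \<noteq> g (South j)"] by blast
  have "letter n v w True x = g x \<and> letter n v w False x = (\<not> g x)" if "x \<in> nodes n" for x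
    using that v w by (cases x) auto
  then show ?thesis using that v(1) w(1) by blast
qed

text \<open>Opposite letters on mirror images fulfil every blob condition automatically, and the two
  copies of a plain line impose the same condition.\<close>

lemma compatible_antisymmetric:
  assumes DB: "(D, B) \<in> blob_diagrams n"
    and h: "\<And>x. x \<in> nodes n \<Longrightarrow> h True x = g x \<and> h False x = (\<not> g x)"
  shows "compatible (D, B) h \<longleftrightarrow> (\<forall>x y. {x, y} \<in> D \<longrightarrow> {x, y} \<notin> B \<longrightarrow> g x \<noteq> g y)"
proof -
  note TL = blob_TL[OF DB]
  have line: "line_compatible ({x, y} \<in> B) h {x, y} \<longleftrightarrow> ({x, y} \<notin> B \<longrightarrow> g x \<noteq> g y)" if "{x, y} \<in> D" for x y
  proof -
    have "x \<in> nodes n" "y \<in> nodes n" "x \<noteq> y" using TL_ends[OF TL that] by auto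
    then show ?thesis using h by (auto simp: line_compatible_pair all_bool_eq)
  qed
  show ?thesis
  proof
    assume *: "compatible (D, B) h"
    show "\<forall>x y. {x, y} \<in> D \<longrightarrow> {x, y} \<notin> B \<longrightarrow> g x \<noteq> g y"
    proof (intro allI impI)
      fix x y assume xy: "{x, y} \<in> D" "{x, y} \<notin> B"
      then have "line_compatible ({x, y} \<in> B) h {x, y}" using * unfolding compatible_def by auto
      then show "g x \<noteq> g y" using line[OF xy(1)] xy(2) by blast
    qed
  next
    assume *: "\<forall>x y. {x, y} \<in> D \<longrightarrow> {x, y} \<notin> B \<longrightarrow> g x \<noteq> g y"
    show "compatible (D, B) h"
      unfolding compatible_def fst_conv snd_conv
    proof
      fix l assume l: "l \<in> D"
      then obtain x y where xy: "l = {x, y}" by (rule TL_lineE[OF TL])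
      show "line_compatible (l \<in> B) h l" using line[of x y] l * unfolding xy by blast
    qed
  qed
qed

section \<open>Faithfulness\<close>

theorem proposition10:
  fixes x q \<gamma> \<delta> :: "'k::comm_ring_1"
    and n :: nat
    and \<rho> :: "(blob_diagram \<Rightarrow> 'k) \<Rightarrow> 'k word_matrix"
    and X Y :: "nat \<Rightarrow> 'k word_matrix"
  assumes "x dvd 1" and "q = x\<^sup>2" and "n \<ge> 1"
    and "mirror_representation n q \<gamma> \<delta> \<rho> X Y"
    and "regular_entries (\<rho> (blob_e n))"
    and "\<And>i. 1 \<le> i \<Longrightarrow> i \<le> n - 1 \<Longrightarrow> regular_entries (X i) \<and> regular_entries (Y i)"
  shows "inj_on \<rho> (carrier (blob_algebra n q \<gamma> \<delta>))"
proof (rule inj_onI, rule ccontr)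
  fix f g
  assume f: "f \<in> carrier (blob_algebra n q \<gamma> \<delta>)" and g: "g \<in> carrier (blob_algebra n q \<gamma> \<delta>)"
    and eq: "\<rho> f = \<rho> g" and "f \<noteq> g"
  have rep: "representation n q \<gamma> \<delta> \<rho>" using assms(4) unfolding mirror_representation_def by blast
  have mask: "has_mask (2 * n) (\<rho> (basis_vec d)) (diagram_mask n d)" if "d \<in> blob_diagrams n" for d
    using mirror_representation_mask[OF assms(3-6) that] by blast
  \<comment> \<open>The triangular argument is run at a diagram of maximal rank among those where
    the coefficients of \<open>f\<close> and \<open>g\<close> differ.\<close>
  define S where "S = {d \<in> blob_diagrams n. f d \<noteq> g d}"
  have "finite S" unfolding S_def using finite_blob_diagrams by simp
  obtain d0 where "f d0 \<noteq> g d0" using \<open>f \<noteq> g\<close> by blast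
  then have "d0 \<in> S" using f g unfolding S_def by (cases d0) (simp add: blob_algebra_def, metis)
  then have "Max ((\<lambda>d. opens_rank n (opens n d)) ` S) \<in> (\<lambda>d. opens_rank n (opens n d)) ` S"
    using \<open>finite S\<close> by (intro Max_in) auto
  then obtain d where d: "d \<in> S"
    and "Max ((\<lambda>d. opens_rank n (opens n d)) ` S) = opens_rank n (opens n d)" by (rule imageE)
  then have max: "opens_rank n (opens n d') \<le> opens_rank n (opens n d)" if "d' \<in> S" for d'
    using Max_ge[of "(\<lambda>d. opens_rank n (opens n d)) ` S"] \<open>finite S\<close> that by (metis finite_imageI imageI)
  obtain v w where words: "v \<in> words (2 * n)" "w \<in> words (2 * n)"
    and letters: "\<And>x. x \<in> nodes n \<Longrightarrow>
      letter n v w True x = opens n d x \<and> letter n v w False x = (\<not> opens n d x)"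
    using antisymmetric_words[of n "opens n d"] by metis
  have mask_iff: "diagram_mask n (D, B) v w \<longleftrightarrow>
      (\<forall>x y. {x, y} \<in> D \<longrightarrow> {x, y} \<notin> B \<longrightarrow> opens n d x \<noteq> opens n d y)"
    if "(D, B) \<in> blob_diagrams n" for D B
    using compatible_antisymmetric[OF that, where h = "letter n v w" and g = "opens n d"] letters words
    unfolding diagram_mask_def by simp
  have dS: "d \<in> blob_diagrams n" "f d \<noteq> g d" using d unfolding S_def by auto
  have "diagram_mask n d v w"
  proof -
    obtain D B where D: "d = (D, B)" by fastforce
    note DB = dS(1)[unfolded D]
    have "opens n (D, B) x \<noteq> opens n (D, B) y" if xy: "{x, y} \<in> D" "{x, y} \<notin> B" for x y
    proof -
      have "pos n x \<noteq> pos n y" using TL_ends[OF blob_TL[OF DB] xy(1)] pos_eq_iff by metis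
      then show ?thesis
        using opens_plain[OF DB xy] opens_plain[OF DB, of y x] xy by (auto simp: insert_commute)
    qed
    then show ?thesis using mask_iff[OF DB] unfolding D by blast
  qed
  then have nonzero: "\<rho> (basis_vec d) v w \<noteq> 0" and "regular_entries (\<rho> (basis_vec d))"
    using mask[OF dS(1)] unfolding has_mask_def by blast+
  \<comment> \<open>A diagram compatible with the test words has rank at least that of
    \<open>d\<close>, and a member of \<open>S\<close> at most that. Equality of the ranks forces
    equal marks, hence equal diagrams, so only \<open>d\<close> contributes to this entry.\<close>
  have others: "(f d' - g d') * \<rho> (basis_vec d') v w = 0" if d': "d' \<in> blob_diagrams n - {d}" for d'
  proof (rule ccontr)
    assume "\<not> ?thesis"
    then have "f d' \<noteq> g d'" and "\<rho> (basis_vec d') v w \<noteq> 0" by auto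
    then have "d' \<in> S" and m: "diagram_mask n d' v w"
      using d' mask[of d'] unfolding S_def has_mask_def by auto
    obtain D B where D: "d' = (D, B)" by fastforce
    have DB: "(D, B) \<in> blob_diagrams n" using d' D by simp
    have g: "\<And>x y. {x, y} \<in> D \<Longrightarrow> {x, y} \<notin> B \<Longrightarrow> opens n d x \<noteq> opens n d y"
      using m mask_iff[OF DB] unfolding D by blast
    have "opens_rank n (opens n d) = opens_rank n (opens n d')"
      using opens_rank_le(1)[OF DB, of "opens n d"] g max[OF \<open>d' \<in> S\<close>] unfolding D by simp
    then have "opens n d x = opens n d' x" if "x \<in> nodes n" for x
      using opens_rank_le(2)[OF DB, of "opens n d" x] g that unfolding D by blast
    then have "d = d'" using opens_inj[OF dS(1)] d' by blast
    then show False using d' by simp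
  qed
  have "0 = \<rho> f v w - \<rho> g v w" using eq by simp
  also have "\<dots> = (\<Sum>d\<in>blob_diagrams n. (f d - g d) * \<rho> (basis_vec d) v w)"
    unfolding representation_sum[OF rep f] representation_sum[OF rep g] sum_subtractf[symmetric] left_diff_distrib ..
  also have "\<dots> = (\<Sum>d\<in>{d}. (f d - g d) * \<rho> (basis_vec d) v w)"
    using dS(1) others by (intro sum.mono_neutral_right finite_blob_diagrams) auto
  finally have "(f d - g d) * \<rho> (basis_vec d) v w = 0" by simp
  then have "f d - g d = 0"
    using nonzero \<open>regular_entries (\<rho> (basis_vec d))\<close> unfolding regular_entries_def by blast
  then show False using dS(2) by simp
qed

end
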